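(* Let $r\ge1$. For any $\lambda=(\lambda_1,\dots,\lambda_{r+1})\in\mathbb{R}^{r+1}$ with $\lambda_1\ge\cdots\ge\lambda_{r+1}$, we have $$V^q(\lambda)=\sum_{u\in\mathbb{S}_r}q^{\ell(u)}\,\mathrm{vol}(\mathbf{C}_\lambda(u)).$$
   Context: $\ell(u)$ is the number of inversions of $u$. The $q$-volume $V^q(\lambda)$. Let $\mathbb{S}_{r+1}$ act on polynomials in $q,x_1,\dots,x_{r+1}$ by permuting the indices of the $x_i$, and set $$\partial_{w_o}(f)=\frac{1}{\prod_{1\le i<j\le r+1}(x_i-x_j)}\sum_{\sigma\in\mathbb{S}_{r+1}}\epsilon(\sigma)\sigma(f),$$ with $\epsilon(\sigma)$ the sign of $\sigma$. Put $\langle f\rangle^q_{r+1}=\partial_{w_o}\bigl(f\prod_{1\le i<j-1\le r}(qx_i-x_j)\bigr)$ (product over pairs $(i,j)$ with $1\le i$, $i<j-1$, $j\le r+1$); if $f$ is homogeneous of degree $r$ in the $x_i$, this is a polynomial in $q$ alone. The $q$-volume is $$V^q(\lambda)=\frac1{r!}\bigl\langle(\lambda_1x_1+\cdots+\lambda_{r+1}x_{r+1})^r\bigr\rangle^q_{r+1}.$$ Equivalently, $V^q(\lambda)=\sum_c A_c(q)\frac{(\lambda_1-\lambda_2)^{c_1}}{c_1!}\cdots\frac{(\lambda_r-\lambda_{r+1})^{c_r}}{c_r!}$, the sum being over sequences $c=(c_1,\dots,c_r)$ of nonnegative integers of sum $r$, with $A_c(q)=\langle x_1^{c_1}(x_1+x_2)^{c_2}\cdots(x_1+\cdots+x_r)^{c_r}\rangle^q_{r+1}$.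 The polytopes $\mathbf{C}_\lambda(u)$. For $\sigma\in\mathbb{S}_{r+1}$ put $\lambda_\sigma=(\lambda_{\sigma(1)},\dots,\lambda_{\sigma(r+1)})$. Embed $\mathbb{S}_r$ in $\mathbb{S}_{r+1}$ as the permutations fixing $r+1$; permutations are multiplied from right to left and $s_i=(i\ i+1)$. For $u\in\mathbb{S}_r$ let $I_u=[u,s_1s_2\cdots s_ru]$ be the interval in the Bruhat order of $\mathbb{S}_{r+1}$; in one-line notation its bottom element is $u_1,\dots,u_r,r+1$ and its top element is $u_1+1,\dots,u_r+1,1$. The polytope $\mathbf{C}_\lambda(u)$ is the convex hull of the points $\lambda_v$, $v\in I_u$. It lies in the hyperplane where the coordinate sum is $\lambda_1+\cdots+\lambda_{r+1}$, and $\mathrm{vol}$ denotes the $r$-dimensional Lebesgue volume of its image under projection to $\mathbb{R}^r$ forgetting the last coordinate. *)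

theory Defs
  imports
    "HOL-Analysis.Analysis"
    "HOL-Library.Function_Algebras"
    "HOL-Library.Poly_Mapping"
    "HOL-Computational_Algebra.Computational_Algebra"
    "HOL-Combinatorics.Permutations"
begin

section \<open>Polynomials in \<open>q\<close> and the \<open>x\<^sub>i\<close>\<close>

text \<open>
  Polynomials in the \<open>x\<^sub>i\<close> (indexed by \<^typ>\<open>nat\<close>) whose coefficients are real
  polynomials in \<open>q\<close>; a monomial is its finitely supported exponent function.
\<close>

type_synonym qpoly = "(nat \<Rightarrow>\<^sub>0 nat) \<Rightarrow>\<^sub>0 real poly"

definition coeff_const :: "real poly \<Rightarrow> qpoly" where
  "coeff_const c = Poly_Mapping.single 0 c"

definition var_q :: "real poly" where
  "var_q = [:0, 1:]"

definition var_x :: "nat \<Rightarrow> qpoly" where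
  "var_x i = Poly_Mapping.single (Poly_Mapping.single i 1) 1"

text \<open>The substitution \<open>x\<^sub>i \<mapsto> x\<^bsub>\<sigma>(i)\<^esub>\<close>; \<open>q\<close> is left alone.\<close>

definition permute_vars :: "(nat \<Rightarrow> nat) \<Rightarrow> qpoly \<Rightarrow> qpoly" where
  "permute_vars \<sigma> f =
     (\<Sum>m\<in>Poly_Mapping.keys f. coeff_const (Poly_Mapping.lookup f m) *
        (\<Prod>i\<in>Poly_Mapping.keys m. var_x (\<sigma> i) ^ Poly_Mapping.lookup m i))"


section \<open>The \<open>q\<close>-volume\<close>

text \<open>
  The division in \<open>\<partial>\<close> takes place in the field of fractions, so \<open>\<partial>\<close>, the bracket and
  the \<open>q\<close>-volume are elements of that field (that they are polynomials is a theorem,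
  not part of the definition). Here \<open>n = r + 1\<close>.
\<close>

definition partial_wo :: "nat \<Rightarrow> qpoly \<Rightarrow> qpoly fract" where
  "partial_wo n f =
     to_fract (\<Sum>\<sigma> | \<sigma> permutes {1..n}. of_int (sign \<sigma>) * permute_vars \<sigma> f) /
     to_fract (\<Prod>(i, j)\<in>{(i, j). 1 \<le> i \<and> i < j \<and> j \<le> n}. var_x i - var_x j)"

definition q_bracket :: "nat \<Rightarrow> qpoly \<Rightarrow> qpoly fract" where
  "q_bracket n f =
     partial_wo n (f * (\<Prod>(i, j)\<in>{(i, j). 1 \<le> i \<and> i + 1 < j \<and> j \<le> n}.
                          coeff_const var_q * var_x i - var_x j))"

definition q_volume :: "nat \<Rightarrow> (nat \<Rightarrow> real) \<Rightarrow> qpoly fract" where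
  "q_volume r lam =
     q_bracket (r + 1) ((\<Sum>i=1..r + 1. coeff_const [:lam i:] * var_x i) ^ r) / of_nat (fact r)"


section \<open>Bruhat order on permutations\<close>

text \<open>
  Elements of the symmetric group on \<open>{1..n}\<close> are functions on \<^typ>\<open>nat\<close> that permute
  \<open>{1..n}\<close> and fix everything else, so the embedding of \<open>S\<^sub>r\<close> into \<open>S\<^bsub>r+1\<^esub>\<close> is
  the identity and the product \<open>u v\<close> is \<open>u \<circ> v\<close>.
\<close>

definition perm_length :: "(nat \<Rightarrow> nat) \<Rightarrow> nat" where
  "perm_length u = card {(i, j). i < j \<and> u j < u i}"

definition bruhat_step :: "nat \<Rightarrow> (nat \<Rightarrow> nat) \<Rightarrow> (nat \<Rightarrow> nat) \<Rightarrow> bool" where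
  "bruhat_step n u v \<longleftrightarrow>
     (\<exists>i\<in>{1..n}. \<exists>j\<in>{1..n}. i \<noteq> j \<and> v = u \<circ> Transposition.transpose i j) \<and>
     perm_length u < perm_length v"

definition bruhat_interval :: "nat \<Rightarrow> (nat \<Rightarrow> nat) \<Rightarrow> (nat \<Rightarrow> nat) \<Rightarrow> (nat \<Rightarrow> nat) set" where
  "bruhat_interval n u v =
     {w. w permutes {1..n} \<and> (bruhat_step n)\<^sup>*\<^sup>* u w \<and> (bruhat_step n)\<^sup>*\<^sup>* w v}"

definition simple_transp :: "nat \<Rightarrow> nat \<Rightarrow> nat" where
  "simple_transp i = Transposition.transpose i (i + 1)"

definition long_cycle :: "nat \<Rightarrow> nat \<Rightarrow> nat" where
  "long_cycle r = foldr (\<circ>) (map simple_transp [1..<r + 1]) id"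


section \<open>The polytopes and their volume\<close>

text \<open>
  Functions form a real vector space under the pointwise operations; this makes
  \<^const>\<open>convex\<close> and \<open>convex hull\<close> available for points with coordinates indexed by
  \<^typ>\<open>nat\<close>.
\<close>

instantiation "fun" :: (type, real_vector) real_vector
begin

definition scaleR_fun :: "real \<Rightarrow> ('a \<Rightarrow> 'b) \<Rightarrow> 'a \<Rightarrow> 'b" where
  "scaleR_fun c f = (\<lambda>x. c *\<^sub>R f x)"

instance
  by standard (simp_all add: scaleR_fun_def fun_eq_iff scaleR_add_right scaleR_add_left)

end

text \<open>
  The point \<open>lam\<^sub>v\<close> is \<open>lam \<circ> v\<close>. Its coordinates outside \<open>{1..r+1}\<close> are those of \<open>lam\<close>,
  hence constant on the convex hull.
\<close>

definition C_polytope :: "nat \<Rightarrow> (nat \<Rightarrow> real) \<Rightarrow> (nat \<Rightarrow> nat) \<Rightarrow> (nat \<Rightarrow> real) set" where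
  "C_polytope r lam u =
     convex hull ((\<lambda>v. lam \<circ> v) ` bruhat_interval (r + 1) u (long_cycle r \<circ> u))"

text \<open>
  Lebesgue measure of the projection to the coordinates \<open>1, \<dots>, r\<close>; the product
  measure lives on functions restricted to \<open>{1..r}\<close>.
\<close>

definition proj_vol :: "nat \<Rightarrow> (nat \<Rightarrow> real) set \<Rightarrow> real" where
  "proj_vol r P = measure (\<Pi>\<^sub>M i\<in>{1..r}. lborel) ((\<lambda>p. restrict p {1..r}) ` P)"

end

theory Submission
  imports Defs
begin

text \<open>
  Both sides of the identity satisfy the same recursion in the number of variables. Write
  \<open>\<lambda>[i:y]\<close> for the sequence \<open>\<lambda>\<close> with the two entries \<open>\<lambda>\<^sub>i, \<lambda>\<^bsub>i+1\<^esub>\<close> replaced by the single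
  entry \<open>y\<close> (\<open>merge i y lam\<close> below). The recursion is
  \<open>V(\<lambda>) = (\<Sum>i=1..r. q\<^bsup>i-1\<^esup> \<integral>y from \<lambda>\<^bsub>i+1\<^esub> to \<lambda>\<^sub>i. V(\<lambda>[i:y]))\<close>, with value \<open>1\<close> at \<open>r = 0\<close>.

  On the side of the polytopes, let \<open>u \<in> S\<^sub>r\<close> have first value \<open>i\<close>, and let \<open>w \<in> S\<^bsub>r-1\<^esub>\<close> be the
  standardization of the remaining values. An element of \<open>I\<^sub>u\<close> has first value \<open>i\<close> or \<open>i + 1\<close>,
  and the standardization of its other values is an arbitrary element of \<open>I\<^sub>w\<close>
  (\<open>bruhat_interval_ins_first\<close>). Taking \<open>\<lambda>\<^sub>i\<close> as first coordinate leaves \<open>\<lambda>\<^bsub>i+1\<^esub>\<close> for later use,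
  and conversely, so on convex hulls the first coordinate \<open>x\<^sub>1\<close> runs through the interval from
  \<open>\<lambda>\<^bsub>i+1\<^esub>\<close> to \<open>\<lambda>\<^sub>i\<close>, and the slice over \<open>x\<^sub>1\<close> is the polytope of \<open>w\<close> for
  \<open>\<lambda>[i: \<lambda>\<^sub>i + \<lambda>\<^bsub>i+1\<^esub> - x\<^sub>1]\<close> (\<open>C_polytope_code\<close>). Fubini's theorem and the reflection
  \<open>x\<^sub>1 \<mapsto> \<lambda>\<^sub>i + \<lambda>\<^bsub>i+1\<^esub> - x\<^sub>1\<close> give the recursion for volumes
  (\<open>proj_vol_C_polytope_ins_first\<close>), and \<open>\<ell>(u) = (i - 1) + \<ell>(w)\<close> gives the powers of \<open>q\<close>.

  On the side of the \<open>q\<close>-volume, the numerator in the definition of \<open>\<partial>\<close> is alternating and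
  homogeneous of the degree of the Vandermonde product. A monomial in such a polynomial has
  pairwise distinct exponents with the smallest possible sum, so all monomials are permutations
  of one another and the polynomial is a multiple of the Vandermonde product
  (\<open>alternating_proportional\<close>). The \<open>q\<close>-volume may therefore be computed at any real point with
  distinct coordinates, in particular at one with \<open>x\<^sub>1 = 0\<close>. In the summand of a permutation
  that puts this zero at position \<open>k\<close>, the factors involving the zero combine with the
  factor between its two new neighbours into \<open>q\<^bsup>k-2\<^esup>/t\<^bsub>k-1\<^esub> - q\<^bsup>k-1\<^esup>/t\<^sub>k\<close>, where \<open>t\<close> lists the other
  coordinates (\<open>q_kernel_zero\<close>). Summing over \<open>k\<close> by parts leaves differences of \<open>r\<close>-th powers of
  linear forms divided by \<open>r! t\<^sub>k\<close>, and these are the integrals in the recursion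
  (\<open>volume_at_Suc_integral\<close>).
\<close>

section \<open>Prepending a value to a permutation\<close>

definition skip :: "nat \<Rightarrow> nat \<Rightarrow> nat" where
  "skip j x = (if j \<le> x then Suc x else x)"

text \<open>
  In one-line notation \<open>ins_first j w\<close> has first value \<open>j\<close>, followed by the values of \<open>w\<close> with
  those from \<open>j\<close> on raised by one. Since \<open>0 - 1 = 0\<close> and permutations fix \<open>0\<close> and everything
  beyond their support, the formula is also right outside the support and needs no bound.
\<close>

definition ins_first :: "nat \<Rightarrow> (nat \<Rightarrow> nat) \<Rightarrow> nat \<Rightarrow> nat" where
  "ins_first j w = (\<lambda>p. if p = 1 then j else skip j (w (p - 1)))"

lemma skip_eq_iff [simp]: "skip j x = skip j y \<longleftrightarrow> x = y"
  by (auto simp: skip_def)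

lemma skip_neq [simp]: "skip j x \<noteq> j" "j \<noteq> skip j x"
  by (auto simp: skip_def)

lemma skip_less_iff [simp]: "skip j x < skip j y \<longleftrightarrow> x < y"
  by (auto simp: skip_def)

lemma skip_less_self [simp]: "skip j x < j \<longleftrightarrow> x < j"
  by (auto simp: skip_def)

lemma atLeastAtMost_Suc_skip:
  assumes "1 \<le> j" "j \<le> Suc n"
  shows "{1..Suc n} = insert j (skip j ` {1..n})"
proof
  show "{1..Suc n} \<subseteq> insert j (skip j ` {1..n})"
  proof
    fix x assume x: "x \<in> {1..Suc n}"
    show "x \<in> insert j (skip j ` {1..n})"
    proof (cases "x = j")
      case False
      then have "x = skip j (if x < j then x else x - 1)" "(if x < j then x else x - 1) \<in> {1..n}"
        using x assms by (auto simp: skip_def)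
      then show ?thesis by blast
    qed simp
  qed
  show "insert j (skip j ` {1..n}) \<subseteq> {1..Suc n}"
    using assms by (auto simp: skip_def)
qed

lemma ins_first_1 [simp]: "ins_first j w 1 = j" "ins_first j w (Suc 0) = j"
  by (simp_all add: ins_first_def)

lemma ins_first_Suc [simp]: "p \<noteq> 0 \<Longrightarrow> ins_first j w (Suc p) = skip j (w p)"
  by (simp add: ins_first_def)

lemma ins_first_permutes:
  assumes "w permutes {1..n}" "1 \<le> j" "j \<le> Suc n"
  shows "ins_first j w permutes {1..Suc n}"
proof (rule bij_imp_permutes)
  have im: "ins_first j w ` {1..Suc n} = {1..Suc n}"
  proof -
    have "{1..Suc n} = insert 1 (Suc ` {1..n})"
      by (simp only: image_Suc_atLeastAtMost) auto
    then have "ins_first j w ` {1..Suc n} = insert j ((\<lambda>p. ins_first j w (Suc p)) ` {1..n})"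
      by (simp only: image_insert image_image ins_first_1)
    also have "(\<lambda>p. ins_first j w (Suc p)) ` {1..n} = (\<lambda>p. skip j (w p)) ` {1..n}"
      by (intro image_cong) auto
    also have "\<dots> = skip j ` {1..n}"
      using permutes_image[OF assms(1)] by (metis image_image)
    also have "insert j \<dots> = {1..Suc n}"
      using atLeastAtMost_Suc_skip[OF assms(2,3)] by simp
    finally show ?thesis .
  qed
  then have "inj_on (ins_first j w) {1..Suc n}"
    by (simp add: eq_card_imp_inj_on)
  with im show "bij_betw (ins_first j w) {1..Suc n} {1..Suc n}"
    by (simp add: bij_betw_def)
next
  fix x assume x: "x \<notin> {1..Suc n}"
  then have "w (x - 1) = x - 1"
    by (intro permutes_not_in[OF assms(1)]) auto
  then show "ins_first j w x = x"
    using x assms by (auto simp: ins_first_def skip_def)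
qed

lemma ins_first_inject:
  assumes "w 0 = 0" "w' 0 = 0" "ins_first j w = ins_first j' w'"
  shows "j = j' \<and> w = w'"
proof
  show j: "j = j'" using fun_cong[OF assms(3), of 1] by simp
  show "w = w'"
  proof
    fix p show "w p = w' p"
      using fun_cong[OF assms(3), of "Suc p"] assms(1,2) j by (cases "p = 0") auto
  qed
qed

lemma permutes_0: "w permutes {1..n} \<Longrightarrow> w 0 = (0::nat)"
  by (rule permutes_not_in) auto

lemma bij_betw_ins_first:
  "bij_betw (\<lambda>(j, w). ins_first j w) ({1..Suc n} \<times> {w. w permutes {1..n}}) {v. v permutes {1..Suc n}}"
  unfolding bij_betw_def
proof
  let ?I = "(\<lambda>(j, w). ins_first j w) ` ({1..Suc n} \<times> {w. w permutes {1..n}})"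
  show inj: "inj_on (\<lambda>(j, w). ins_first j w) ({1..Suc n} \<times> {w. w permutes {1..n}})"
  proof (rule inj_onI, clarify)
    fix j w j' w' assume "w permutes {1..n}" "w' permutes {1..n}" "ins_first j w = ins_first j' w'"
    then show "j = j' \<and> w = w'" by (intro ins_first_inject permutes_0)
  qed
  \<comment> \<open>the map lands in a set with exactly as many elements, so it is onto\<close>
  have "card ?I = Suc n * fact n"
    using card_image[OF inj] by (simp add: card_permutations[of _ n] card_cartesian_product)
  also have "\<dots> = card {v. v permutes {1..Suc n}}"
    by (simp add: card_permutations[of _ "Suc n"])
  finally show "?I = {v. v permutes {1..Suc n}}"
    by (intro card_subset_eq) (auto simp: finite_permutations intro!: ins_first_permutes[simplified])
qed

lemma permutes_ins_firstE:
  assumes "v permutes {1..Suc n}"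
  obtains j w where "j \<in> {1..Suc n}" "w permutes {1..n}" "v = ins_first j w"
proof -
  from assms have "v \<in> (\<lambda>(j, w). ins_first j w) ` ({1..Suc n} \<times> {w. w permutes {1..n}})"
    using bij_betw_ins_first[of n] by (simp add: bij_betw_def)
  with that show thesis by auto
qed

lemma sum_permutes_ins_first:
  "(\<Sum>v | v permutes {1..Suc n}. f v) = (\<Sum>j=1..Suc n. \<Sum>w | w permutes {1..n}. f (ins_first j w))"
  unfolding sum.cartesian_product
  using sum.reindex_bij_betw[OF bij_betw_ins_first, of f n]
  by (simp add: case_prod_unfold)

lemma (in comm_monoid_set) split_head:
  "F g {1..Suc n} = g 1 \<^bold>* F (\<lambda>p. g (Suc p)) {1..n}"
  using atLeast_Suc_atMost[of 1 "Suc n" g] shift_bounds_cl_Suc_ivl[of g 1 n] by simp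

lemma (in comm_monoid_set) split_skip:
  assumes "1 \<le> k" "k \<le> Suc n"
  shows "F g {1..Suc n} = g k \<^bold>* F (\<lambda>i. g (skip k i)) {1..n}"
  unfolding atLeastAtMost_Suc_skip[OF assms]
  by (subst insert) (auto simp: reindex inj_on_def)

lemma (in comm_monoid_set) double_split_two:
  assumes "finite S" "a \<in> S" "b \<in> S" "a \<noteq> b"
  shows "F (\<lambda>i. F (\<lambda>j. g i j) S) S = g a a \<^bold>* g b b \<^bold>* g a b \<^bold>* g b a \<^bold>*
     F (\<lambda>c. g a c \<^bold>* g c a \<^bold>* g b c \<^bold>* g c b) (S - {a, b}) \<^bold>*
     F (\<lambda>i. F (\<lambda>j. g i j) (S - {a, b})) (S - {a, b})"
proof -
  have S: "F h S = h a \<^bold>* h b \<^bold>* F h (S - {a, b})" for h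
  proof -
    have "S = insert a (insert b (S - {a, b}))" using assms by auto
    then have "F h S = F h (insert a (insert b (S - {a, b})))" by simp
    also have "\<dots> = h a \<^bold>* h b \<^bold>* F h (S - {a, b})" using assms by (simp add: assoc)
    finally show ?thesis .
  qed
  show ?thesis
    unfolding S by (simp add: distrib ac_simps)
qed

section \<open>Inversions\<close>

text \<open>
  The number of inversions is written as a sum over a fixed index set, so that the effect of a
  transposition can be read off by splitting two indices from the sum.
\<close>

lemma perm_length_double_sum:
  assumes "u permutes {1..n}"
  shows "perm_length u = (\<Sum>i\<in>{1..n}. \<Sum>j\<in>{1..n}. if i < j \<and> u j < u i then 1 else 0)"
proof -
  have in_range: "i \<in> {1..n} \<and> j \<in> {1..n}" if ij: "i < j" "u j < u i" for i j
  proof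
    show i: "i \<in> {1..n}"
    proof (rule ccontr)
      assume i: "i \<notin> {1..n}"
      have ui: "u i = i" using i by (rule permutes_not_in[OF assms])
      have "j \<notin> {1..n}" using ui ij permutes_in_image[OF assms, of j] i by auto
      then have "u j = j" by (rule permutes_not_in[OF assms])
      then show False using ui ij by linarith
    qed
    show "j \<in> {1..n}"
    proof (rule ccontr)
      assume j: "j \<notin> {1..n}"
      then have "u j = j" by (rule permutes_not_in[OF assms])
      moreover have "u i \<in> {1..n}" using permutes_in_image[OF assms] i by blast
      ultimately show False using ij i j by auto
    qed
  qed
  have *: "{(i, j). i < j \<and> u j < u i} = {x \<in> {1..n} \<times> {1..n}. fst x < snd x \<and> u (snd x) < u (fst x)}"
    using in_range by (intro set_eqI) (simp only: split_paired_all mem_Collect_eq case_prod_conv fst_conv snd_conv mem_Sigma_iff, blast)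
  have "perm_length u = (\<Sum>x\<in>{1..n}\<times>{1..n}. if fst x < snd x \<and> u (snd x) < u (fst x) then 1 else 0)"
    unfolding perm_length_def * by (subst sum.inter_filter[symmetric]) simp_all
  then show ?thesis
    by (simp add: sum.cartesian_product case_prod_unfold)
qed

text \<open>
  The first value \<open>j\<close> forms an inversion with each of the \<open>j - 1\<close> smaller values, all of which
  come later; the order of the other values is that of \<open>w\<close>.
\<close>

lemma perm_length_ins_first:
  assumes w: "w permutes {1..n}" and j: "1 \<le> j" "j \<le> Suc n"
  shows "perm_length (ins_first j w) = (j - 1) + perm_length w"
proof -
  have c: "(\<Sum>p\<in>{1..n}. if w p < j then 1 else 0) = j - (1::nat)"
  proof -
    have "(\<Sum>p\<in>{1..n}. if w p < j then 1 else (0::nat)) = (\<Sum>p\<in>{1..n}. if p < j then 1 else 0)"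
      using sum.permute[OF w, of "\<lambda>p. if p < j then 1 else (0::nat)"] by (simp add: o_def)
    also have "\<dots> = card {p\<in>{1..n}. p < j}" by (simp add: sum.If_cases Int_def)
    also have "{p\<in>{1..n}. p < j} = {1..<j}" using j by auto
    finally show ?thesis by simp
  qed
  have "perm_length (ins_first j w) =
      (\<Sum>p\<in>{1..n}. if w p < j then 1 else 0) + perm_length w"
    unfolding perm_length_double_sum[OF ins_first_permutes[OF w j]] perm_length_double_sum[OF w]
      sum.split_head by (auto intro!: sum.cong arg_cong2[where f = "(+)"])
  with c show ?thesis by simp
qed

section \<open>The long cycle\<close>

lemma long_cycle_Suc: "long_cycle (Suc r) = long_cycle r \<circ> simple_transp (Suc r)"
proof -
  have *: "foldr (\<circ>) xs f = foldr (\<circ>) xs id \<circ> f" for xs and f :: "nat \<Rightarrow> nat"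
    by (induction xs) (auto simp: o_assoc)
  show ?thesis
    unfolding long_cycle_def by (simp add: *[of _ "simple_transp (Suc r)"])
qed

lemma long_cycle_apply:
  "long_cycle r p = (if p \<in> {1..r} then Suc p else if p = Suc r then 1 else p)"
proof (induction r arbitrary: p)
  case 0
  then show ?case by (simp add: long_cycle_def)
next
  case (Suc r)
  show ?case
    unfolding long_cycle_Suc comp_apply Suc.IH simple_transp_def
    by (auto simp: Transposition.transpose_def)
qed

text \<open>
  The top elements of the intervals follow the same pattern as the bottom ones, except that the
  first value is raised by one.
\<close>

lemma long_cycle_ins_first:
  assumes "1 \<le> i" "i \<le> Suc r"
  shows "long_cycle (Suc r) \<circ> ins_first i u = ins_first (Suc i) (long_cycle r \<circ> u)"
proof
  fix p
  show "(long_cycle (Suc r) \<circ> ins_first i u) p = ins_first (Suc i) (long_cycle r \<circ> u) p"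
    using assms by (auto simp: ins_first_def long_cycle_apply skip_def)
qed

section \<open>Bruhat intervals from a permutation to its long cycle shift\<close>

text \<open>
  Only inversions that involve position \<open>a\<close> or \<open>b\<close> change. An index outside the interval from
  \<open>a\<close> to \<open>b\<close> keeps its number of inversions with the pair, an index inside cannot lose any,
  and the pair itself becomes an inversion.
\<close>

lemma perm_length_transpose_less:
  assumes u: "u permutes {1..n}" and ab: "a \<in> {1..n}" "b \<in> {1..n}" "a < b" "u a < u b"
  shows "perm_length u < perm_length (u \<circ> Transposition.transpose a b)"
proof -
  let ?t = "Transposition.transpose a b"
  have v: "u \<circ> ?t permutes {1..n}"
    using ab u by (intro permutes_compose permutes_swap_id)
  have S: "finite {1..n}" "a \<noteq> b" using ab by auto
  show ?thesis
    unfolding perm_length_double_sum[OF u] perm_length_double_sum[OF v]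
      sum.double_split_two[OF S(1) ab(1,2) S(2)]
  proof (rule add_less_le_mono[OF add_less_le_mono]; (rule sum_mono)?)
    fix i assume "i \<in> {1..n} - {a, b}"
    then have i: "i \<noteq> a" "i \<noteq> b" by auto
    from i have t: "(u \<circ> ?t) i = u i" "(u \<circ> ?t) a = u b" "(u \<circ> ?t) b = u a"
      by (simp_all add: Transposition.transpose_def)
    consider "i < a" | "a < i" "i < b" | "b < i" using i ab(3) by linarith
    then show "(if a < i \<and> u i < u a then 1 else 0) + (if i < a \<and> u a < u i then 1 else 0) +
          (if b < i \<and> u i < u b then 1 else 0) + (if i < b \<and> u b < u i then 1 else 0)
         \<le> (if a < i \<and> (u \<circ> ?t) i < (u \<circ> ?t) a then 1 else 0) +
            (if i < a \<and> (u \<circ> ?t) a < (u \<circ> ?t) i then 1 else 0) +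
            (if b < i \<and> (u \<circ> ?t) i < (u \<circ> ?t) b then 1 else 0) +
            (if i < b \<and> (u \<circ> ?t) b < (u \<circ> ?t) i then 1 else (0::nat))"
      unfolding t using ab(3,4) by cases auto
  qed (use ab in \<open>auto simp: Transposition.transpose_def\<close>)
qed

text \<open>
  The length condition on a Bruhat step decides the direction of the exchange: exchanging an
  inverted pair would shorten the permutation by the preceding lemma, applied backwards.
\<close>

lemma bruhat_stepE:
  assumes "bruhat_step n u v" "u permutes {1..n}"
  obtains a b where "a \<in> {1..n}" "b \<in> {1..n}" "a < b" "u a < u b" "v = u \<circ> Transposition.transpose a b"
proof -
  from assms(1) obtain i j where ij: "i \<in> {1..n}" "j \<in> {1..n}" "i \<noteq> j" "v = u \<circ> Transposition.transpose i j"
    and l: "perm_length u < perm_length v" by (auto simp: bruhat_step_def)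
  define a b where "a = min i j" and "b = max i j"
  have ab: "a \<in> {1..n}" "b \<in> {1..n}" "a < b" "v = u \<circ> Transposition.transpose a b"
    using ij by (auto simp: a_def b_def min_def max_def transpose_commute)
  have v: "v permutes {1..n}"
    using ab assms(2) by (auto intro!: permutes_compose permutes_swap_id)
  have "u a < u b"
  proof (rule ccontr)
    assume "\<not> u a < u b"
    moreover have "u a \<noteq> u b" using ab permutes_inj[OF assms(2)] by (auto dest: injD)
    ultimately have "v a < v b" using ab by simp
    have "v \<circ> Transposition.transpose a b = u" using ab by (simp add: fun_eq_iff)
    with perm_length_transpose_less[OF v ab(1-3) \<open>v a < v b\<close>] have "perm_length v < perm_length u"
      by simp
    with l show False by simp
  qed
  with ab that show thesis by blast
qed

lemma bruhat_step_permutes: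
  assumes "bruhat_step n u v" "u permutes {1..n}"
  shows "v permutes {1..n}"
  using assms
proof (rule bruhat_stepE)
  fix a b assume ab: "a \<in> {1..n}" "b \<in> {1..n}" "v = u \<circ> Transposition.transpose a b"
  show ?thesis unfolding ab(3)
    by (rule permutes_compose[OF permutes_swap_id[OF ab(1,2)] assms(2)])
qed

text \<open>
  These are the rank numbers of the tableau criterion for the Bruhat order. They increase along
  Bruhat steps, which is the easy half of the criterion; for the intervals at hand this necessary
  condition turns out to be sufficient.
\<close>

definition count_ge :: "(nat \<Rightarrow> nat) \<Rightarrow> nat \<Rightarrow> nat \<Rightarrow> nat" where
  "count_ge v k m = card {p \<in> {1..k}. m \<le> v p}"

lemma count_ge_step:
  assumes "bruhat_step n u v" "u permutes {1..n}"
  shows "count_ge u k m \<le> count_ge v k m"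
  using assms
proof (rule bruhat_stepE)
  fix a b assume ab: "a \<in> {1..n}" "b \<in> {1..n}" "a < b" "u a < u b" and v: "v = u \<circ> Transposition.transpose a b"
  show ?thesis
  \<comment> \<open>an exchange with both positions among the first \<open>k\<close> permutes the counted positions\<close>
  proof (cases "b \<le> k")
    case False
    then have "{p \<in> {1..k}. m \<le> u p} \<subseteq> {p \<in> {1..k}. m \<le> v p}"
      using ab v by (auto simp: Transposition.transpose_def)
    then show ?thesis unfolding count_ge_def by (intro card_mono) auto
  next
    case True
    then have "a \<le> k" using ab by linarith
    have "{p \<in> {1..k}. m \<le> u p} = Transposition.transpose a b ` {p \<in> {1..k}. m \<le> v p}"
    proof (intro equalityI subsetI)
      fix x assume "x \<in> {p \<in> {1..k}. m \<le> u p}"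
      then show "x \<in> Transposition.transpose a b ` {p \<in> {1..k}. m \<le> v p}"
        using ab v True \<open>a \<le> k\<close> by (intro image_eqI[of _ _ "Transposition.transpose a b x"])
          (auto simp: Transposition.transpose_def)
    qed (use ab v True \<open>a \<le> k\<close> in \<open>auto simp: Transposition.transpose_def split: if_splits\<close>)
    then have "count_ge u k m = card (Transposition.transpose a b ` {p \<in> {1..k}. m \<le> v p})"
      by (simp only: count_ge_def)
    also have "\<dots> = count_ge v k m"
      unfolding count_ge_def by (intro card_image inj_on_subset[OF inj_transpose]) auto
    finally show ?thesis by simp
  qed
qed

lemma bruhat_chain:
  assumes "(bruhat_step n)\<^sup>*\<^sup>* u v" "u permutes {1..n}"
  shows "v permutes {1..n}" "count_ge u k m \<le> count_ge v k m"
proof -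
  have "v permutes {1..n} \<and> count_ge u k m \<le> count_ge v k m"
    using assms
  proof (induction rule: rtranclp_induct)
    case (step y z)
    then show ?case using count_ge_step[of n y z k m] bruhat_step_permutes[of n y z] by auto
  qed auto
  then show "v permutes {1..n}" "count_ge u k m \<le> count_ge v k m" by auto
qed

lemma bruhat_step_ins_first:
  assumes "bruhat_step n w w'" "w permutes {1..n}" "1 \<le> j" "j \<le> Suc n"
  shows "bruhat_step (Suc n) (ins_first j w) (ins_first j w')"
proof -
  from assms(1,2) obtain a b where ab: "a \<in> {1..n}" "b \<in> {1..n}" "a < b"
    "w' = w \<circ> Transposition.transpose a b" by (rule bruhat_stepE)
  have "ins_first j w' = ins_first j w \<circ> Transposition.transpose (Suc a) (Suc b)"
  proof
    fix p show "ins_first j w' p = (ins_first j w \<circ> Transposition.transpose (Suc a) (Suc b)) p"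
      using ab by (auto simp: ins_first_def Transposition.transpose_def)
  qed
  moreover have "perm_length w < perm_length w'" using assms(1) by (simp add: bruhat_step_def)
  then have "perm_length (ins_first j w) < perm_length (ins_first j w')"
    using bruhat_step_permutes[OF assms(1,2)] assms(2-4) by (simp add: perm_length_ins_first)
  moreover have "Suc a \<in> {1..Suc n}" "Suc b \<in> {1..Suc n}" "Suc a \<noteq> Suc b" using ab by auto
  ultimately show ?thesis unfolding bruhat_step_def by blast
qed

lemma bruhat_chain_ins_first:
  assumes "(bruhat_step n)\<^sup>*\<^sup>* w w'" "w permutes {1..n}" "1 \<le> j" "j \<le> Suc n"
  shows "(bruhat_step (Suc n))\<^sup>*\<^sup>* (ins_first j w) (ins_first j w')"
  using assms(1)
proof (induction rule: rtranclp_induct)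
  case (step y z)
  have "y permutes {1..n}" using bruhat_chain(1) step(1) assms(2) by blast
  with step show ?case using bruhat_step_ins_first[of n y z j] assms by (meson rtranclp.rtrancl_into_rtrancl)
qed auto

text \<open>
  Raising the first value from \<open>i\<close> to \<open>i + 1\<close> exchanges it with the value \<open>i + 1\<close>, which occurs
  later.
\<close>

lemma bruhat_step_ins_first_Suc:
  assumes w: "w permutes {1..n}" and i: "1 \<le> i" "i \<le> n"
  shows "bruhat_step (Suc n) (ins_first i w) (ins_first (Suc i) w)"
proof -
  define p where "p = inv w i"
  have wp: "w p = i" using permutes_inverses(1)[OF w] by (simp add: p_def)
  have p: "p \<in> {1..n}" using permutes_in_image[OF permutes_inv[OF w], of i] i by (simp add: p_def)
  have inj: "w x = i \<longleftrightarrow> x = p" for x using wp permutes_inj[OF w] by (auto dest: injD)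
  have "ins_first (Suc i) w = ins_first i w \<circ> Transposition.transpose 1 (Suc p)"
  proof
    fix x
    have "x \<noteq> 1 \<Longrightarrow> x \<noteq> Suc p \<Longrightarrow> w (x - 1) \<noteq> i" using inj[of "x - 1"] p by auto
    then show "ins_first (Suc i) w x = (ins_first i w \<circ> Transposition.transpose 1 (Suc p)) x"
      using wp p by (auto simp: ins_first_def Transposition.transpose_def skip_def)
  qed
  moreover have "perm_length (ins_first i w) < perm_length (ins_first (Suc i) w)"
    using i w by (simp add: perm_length_ins_first)
  moreover have "1 \<in> {1..Suc n}" "Suc p \<in> {1..Suc n}" "1 \<noteq> Suc p" using p by auto
  ultimately show ?thesis unfolding bruhat_step_def by blast
qed

lemma Collect_ins_first:
  "{p \<in> {1..Suc k}. P (ins_first j w p)} =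
     (if P j then {1} else {}) \<union> Suc ` {p\<in>{1..k}. P (skip j (w p))}"
proof (intro equalityI subsetI)
  fix x assume x: "x \<in> {p \<in> {1..Suc k}. P (ins_first j w p)}"
  show "x \<in> (if P j then {1} else {}) \<union> Suc ` {p\<in>{1..k}. P (skip j (w p))}"
  proof (cases "x = 1")
    case False
    with x have "x = Suc (x - 1)" "x - 1 \<in> {p\<in>{1..k}. P (skip j (w p))}"
      by (auto simp: ins_first_def)
    then show ?thesis by blast
  qed (use x in auto)
qed (auto split: if_splits)

text \<open>
  The count of \<open>w\<close> at threshold \<open>j\<close> can be read off from either formula. When permutations with first
  values \<open>i\<close> and \<open>i + 1\<close> are compared, one formula therefore applies to both, whatever the threshold.
\<close>

lemma count_ge_ins_first:
  shows "m \<le> j \<Longrightarrow> count_ge (ins_first j w) (Suc k) m = Suc (count_ge w k m)"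
    and "j \<le> m \<Longrightarrow> count_ge (ins_first j w) (Suc k) (Suc m) = count_ge w k m"
proof -
  assume "m \<le> j"
  then have "{p\<in>{1..k}. m \<le> skip j (w p)} = {p\<in>{1..k}. m \<le> w p}" by (auto simp: skip_def)
  with \<open>m \<le> j\<close> show "count_ge (ins_first j w) (Suc k) m = Suc (count_ge w k m)"
    unfolding count_ge_def Collect_ins_first[of k "\<lambda>x. m \<le> x"]
    by (simp add: card_insert_if image_iff card_image)
next
  assume "j \<le> m"
  then have "{p\<in>{1..k}. Suc m \<le> skip j (w p)} = {p\<in>{1..k}. m \<le> w p}" by (auto simp: skip_def)
  with \<open>j \<le> m\<close> show "count_ge (ins_first j w) (Suc k) (Suc m) = count_ge w k m"
    unfolding count_ge_def Collect_ins_first[of k "\<lambda>x. Suc m \<le> x"]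
    by (simp add: card_image)
qed

definition count_interval :: "nat \<Rightarrow> (nat \<Rightarrow> nat) \<Rightarrow> (nat \<Rightarrow> nat) \<Rightarrow> (nat \<Rightarrow> nat) set" where
  "count_interval n u v = {w. w permutes {1..n} \<and>
     (\<forall>k m. count_ge u k m \<le> count_ge w k m \<and> count_ge w k m \<le> count_ge v k m)}"

lemma bruhat_interval_subset_count_interval:
  assumes "u permutes {1..n}"
  shows "bruhat_interval n u v \<subseteq> count_interval n u v"
proof
  fix w assume "w \<in> bruhat_interval n u v"
  then have w: "w permutes {1..n}" "(bruhat_step n)\<^sup>*\<^sup>* u w" "(bruhat_step n)\<^sup>*\<^sup>* w v"
    by (simp_all add: bruhat_interval_def)
  then show "w \<in> count_interval n u v"
    unfolding count_interval_def mem_Collect_eq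
    using bruhat_chain(2)[OF w(2) assms] bruhat_chain(2)[OF w(3) w(1)] by blast
qed

text \<open>
  The counts over the first position alone force the first value to be \<open>i\<close> or \<open>i + 1\<close>, and then
  the inequalities between counts descend to the rest: thresholds up to \<open>i\<close> lose one on every
  side, thresholds above \<open>i\<close> are shifted by one on every side.
\<close>

lemma count_interval_ins_first:
  assumes "v \<in> count_interval (Suc n) (ins_first i u) (ins_first (Suc i) u')"
  obtains j w where "j \<in> {i, Suc i}" "v = ins_first j w" "w \<in> count_interval n u u'"
proof -
  from assms have v: "v permutes {1..Suc n}"
    and lo: "\<And>k m. count_ge (ins_first i u) k m \<le> count_ge v k m"
    and hi: "\<And>k m. count_ge v k m \<le> count_ge (ins_first (Suc i) u') k m"
    by (auto simp: count_interval_def)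
  obtain j w where jw: "j \<in> {1..Suc n}" "w permutes {1..n}" "v = ins_first j w"
    using permutes_ins_firstE[OF v] by blast
  have c1: "count_ge x 1 m = (if m \<le> x 1 then 1 else 0)" for x m
  proof -
    have "{p \<in> {1..1}. m \<le> x p} = (if m \<le> x 1 then {1} else {})" by auto
    then show ?thesis by (simp add: count_ge_def)
  qed
  have "i \<le> j" using lo[of 1 i] jw unfolding c1 by (auto split: if_splits)
  moreover have "j \<le> Suc i" using hi[of 1 j] jw unfolding c1 by (auto split: if_splits)
  ultimately have j: "j = i \<or> j = Suc i" by auto
  have "count_ge u k m \<le> count_ge w k m \<and> count_ge w k m \<le> count_ge u' k m" for k m
  proof (cases "m \<le> i")
    case True
    then show ?thesis using lo[of "Suc k" m] hi[of "Suc k" m] j jw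
      by (auto simp: count_ge_ins_first(1))
  next
    case False
    then show ?thesis using lo[of "Suc k" "Suc m"] hi[of "Suc k" "Suc m"] j jw
      by (auto simp: count_ge_ins_first(2))
  qed
  with j jw that show thesis by (auto simp: count_interval_def)
qed

text \<open>
  Chains from \<open>u\<close> to \<open>w\<close> and from \<open>w\<close> to the top lift under any fixed first value; a single
  step that raises the first value from \<open>i\<close> to \<open>i + 1\<close> is added to the lower chain or to the upper one.
\<close>

lemma ins_first_mem_bruhat_interval:
  assumes u: "u permutes {1..r}" and i: "1 \<le> i" "i \<le> Suc r"
    and w: "w \<in> bruhat_interval (Suc r) u (long_cycle r \<circ> u)" and j: "j = i \<or> j = Suc i"
  shows "ins_first j w \<in> bruhat_interval (Suc (Suc r)) (ins_first i u) (long_cycle (Suc r) \<circ> ins_first i u)"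
proof -
  have u': "u permutes {1..Suc r}" using u by (rule permutes_subset) auto
  have w': "w permutes {1..Suc r}" "(bruhat_step (Suc r))\<^sup>*\<^sup>* u w"
    "(bruhat_step (Suc r))\<^sup>*\<^sup>* w (long_cycle r \<circ> u)"
    using w by (auto simp: bruhat_interval_def)
  have lo: "(bruhat_step (Suc (Suc r)))\<^sup>*\<^sup>* (ins_first k u) (ins_first k w)" if "k \<in> {i, Suc i}" for k
    using that i by (intro bruhat_chain_ins_first w' u') auto
  have hi: "(bruhat_step (Suc (Suc r)))\<^sup>*\<^sup>* (ins_first k w) (ins_first k (long_cycle r \<circ> u))"
    if "k \<in> {i, Suc i}" for k
    using that i by (intro bruhat_chain_ins_first w' u') auto
  have st: "bruhat_step (Suc (Suc r)) (ins_first i x) (ins_first (Suc i) x)" if "x permutes {1..Suc r}" for x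
    using bruhat_step_ins_first_Suc[OF that i] .
  have "(bruhat_step (Suc (Suc r)))\<^sup>*\<^sup>* (ins_first i u) (ins_first j w)"
    using j lo[of i] converse_rtranclp_into_rtranclp[OF st[OF u'] lo[of "Suc i"]] by blast
  moreover have "(bruhat_step (Suc (Suc r)))\<^sup>*\<^sup>* (ins_first j w) (ins_first (Suc i) (long_cycle r \<circ> u))"
    using j hi[of "Suc i"] converse_rtranclp_into_rtranclp[OF st[OF w'(1)] hi[of "Suc i"]] by blast
  moreover have "ins_first j w permutes {1..Suc (Suc r)}"
    using j i by (intro ins_first_permutes w') auto
  ultimately show ?thesis
    using long_cycle_ins_first[OF i, of u] by (simp add: bruhat_interval_def)
qed

lemma count_interval_subset_bruhat_interval:
  assumes "u permutes {1..r}"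
  shows "count_interval (Suc r) u (long_cycle r \<circ> u) \<subseteq> bruhat_interval (Suc r) u (long_cycle r \<circ> u)"
  using assms
proof (induction r arbitrary: u)
  case 0
  have 1: "v = id" if "v permutes {1..Suc 0}" for v :: "nat \<Rightarrow> nat" using that by simp
  show ?case using 0 by (auto simp: count_interval_def bruhat_interval_def long_cycle_def id_def[symmetric] dest!: 1)
next
  case (Suc r)
  obtain i w where iw: "i \<in> {1..Suc r}" "w permutes {1..r}" "u = ins_first i w"
    using permutes_ins_firstE[OF Suc.prems] by blast
  have lc: "long_cycle (Suc r) \<circ> u = ins_first (Suc i) (long_cycle r \<circ> w)"
    using iw by (simp add: long_cycle_ins_first)
  show ?case
  proof
    fix v assume "v \<in> count_interval (Suc (Suc r)) u (long_cycle (Suc r) \<circ> u)"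
    then have v: "v \<in> count_interval (Suc (Suc r)) (ins_first i w) (ins_first (Suc i) (long_cycle r \<circ> w))"
      using iw lc by simp
    then obtain j w' where jw: "j \<in> {i, Suc i}" "v = ins_first j w'"
      "w' \<in> count_interval (Suc r) w (long_cycle r \<circ> w)"
      by (rule count_interval_ins_first)
    have "w' \<in> bruhat_interval (Suc r) w (long_cycle r \<circ> w)"
      using jw(3) by (rule set_mp[OF Suc.IH[OF iw(2)]])
    from ins_first_mem_bruhat_interval[OF iw(2) _ _ this] jw(1,2) iw(1,3)
    show "v \<in> bruhat_interval (Suc (Suc r)) u (long_cycle (Suc r) \<circ> u)"
      by auto
  qed
qed

text \<open>
  The recursive structure of the intervals, on which the recursion for the polytopes rests.
\<close>

lemma bruhat_interval_ins_first:
  assumes u: "u permutes {1..r}" and i: "1 \<le> i" "i \<le> Suc r"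
  shows "bruhat_interval (Suc (Suc r)) (ins_first i u) (long_cycle (Suc r) \<circ> ins_first i u) =
    (\<Union>j\<in>{i, Suc i}. ins_first j ` bruhat_interval (Suc r) u (long_cycle r \<circ> u))"
proof (intro equalityI subsetI)
  fix v assume "v \<in> bruhat_interval (Suc (Suc r)) (ins_first i u) (long_cycle (Suc r) \<circ> ins_first i u)"
  moreover have "ins_first i u permutes {1..Suc (Suc r)}"
    by (rule permutes_subset[OF ins_first_permutes[OF u i]]) auto
  ultimately have "v \<in> count_interval (Suc (Suc r)) (ins_first i u) (ins_first (Suc i) (long_cycle r \<circ> u))"
    using bruhat_interval_subset_count_interval long_cycle_ins_first[OF i, of u] by fastforce
  then obtain j w where "j \<in> {i, Suc i}" "v = ins_first j w"
      "w \<in> count_interval (Suc r) u (long_cycle r \<circ> u)"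
    by (rule count_interval_ins_first)
  with count_interval_subset_bruhat_interval[OF u]
  show "v \<in> (\<Union>j\<in>{i, Suc i}. ins_first j ` bruhat_interval (Suc r) u (long_cycle r \<circ> u))"
    by blast
next
  fix v assume "v \<in> (\<Union>j\<in>{i, Suc i}. ins_first j ` bruhat_interval (Suc r) u (long_cycle r \<circ> u))"
  then show "v \<in> bruhat_interval (Suc (Suc r)) (ins_first i u) (long_cycle (Suc r) \<circ> ins_first i u)"
    using ins_first_mem_bruhat_interval[OF u i] by auto
qed

section \<open>The polytopes as cubes with moving bounds\<close>

definition dominant :: "nat \<Rightarrow> (nat \<Rightarrow> real) \<Rightarrow> bool" where
  "dominant n lam \<longleftrightarrow> (\<forall>i j. 1 \<le> i \<longrightarrow> i \<le> j \<longrightarrow> j \<le> n \<longrightarrow> lam j \<le> lam i)"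

definition merge :: "nat \<Rightarrow> real \<Rightarrow> (nat \<Rightarrow> real) \<Rightarrow> nat \<Rightarrow> real" where
  "merge i y lam = (\<lambda>j. if j < i then lam j else if j = i then y else lam (Suc j))"

text \<open>
  This is where the order of the entries matters: a value between two neighbours may
  replace them.
\<close>

lemma dominant_merge:
  assumes "dominant (Suc n) lam" "1 \<le> i" "i \<le> n" "lam (Suc i) \<le> y" "y \<le> lam i"
  shows "dominant n (merge i y lam)"
  unfolding dominant_def
proof (intro allI impI)
  fix a b assume ab: "1 \<le> a" "a \<le> b" "b \<le> n"
  have d: "lam l \<le> lam k" if "1 \<le> k" "k \<le> l" "l \<le> Suc n" for k l
    using assms(1) that by (auto simp: dominant_def)
  consider "b < i" | "b = i" "a < i" | "b = i" "a = i" | "i < b" "a < i" | "i < b" "a = i" | "i < b" "i < a"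
    using ab(2) by linarith
  then show "merge i y lam b \<le> merge i y lam a"
  proof cases
    case 2
    then show ?thesis using d[of a i] ab assms by (simp add: merge_def)
  next
    case 5
    then show ?thesis using d[of "Suc i" "Suc b"] ab assms by (simp add: merge_def)
  qed (use d ab assms in \<open>simp_all add: merge_def\<close>)
qed

lemma merge_upper: "merge i (lam (Suc i)) lam x = lam (skip i x)"
  by (simp add: merge_def skip_def)

lemma merge_lower: "merge i (lam i) lam x = lam (skip (Suc i) x)"
  by (auto simp: merge_def skip_def)

definition fcons :: "'a \<Rightarrow> (nat \<Rightarrow> 'a) \<Rightarrow> nat \<Rightarrow> 'a" where
  "fcons a z = (\<lambda>p. if p = 1 then a else z (p - 1))"

definition ftail :: "(nat \<Rightarrow> 'a) \<Rightarrow> nat \<Rightarrow> 'a" where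
  "ftail x = (\<lambda>p. if p = 0 then x 0 else x (Suc p))"

lemma fcons_ftail: "fcons (x 1) (ftail x) = x"
proof
  fix p show "fcons (x 1) (ftail x) p = x p"
    by (cases "p \<le> 1") (auto simp: fcons_def ftail_def le_Suc_eq)
qed

lemma ftail_fcons: "ftail (fcons a z) = z"
  by (auto simp: fcons_def ftail_def)

lemma fcons_1 [simp]: "fcons a z 1 = a" "fcons a z (Suc 0) = a"
  by (simp_all add: fcons_def)

text \<open>
  The vertex with first value \<open>i\<close> uses up \<open>lam i\<close> and leaves \<open>lam (Suc i)\<close> in the merged
  place, and vice versa.
\<close>

lemma comp_ins_first:
  shows "lam \<circ> ins_first i w = fcons (lam i) (merge i (lam (Suc i)) lam \<circ> w)"
    and "lam \<circ> ins_first (Suc i) w = fcons (lam (Suc i)) (merge i (lam i) lam \<circ> w)"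
  by (auto simp: ins_first_def fcons_def merge_upper merge_lower)

text \<open>
  A permutation is recorded by the list of values prepended in turn, that is, by its Lehmer code
  shifted by one. Recursion on this list makes the polytopes and their volumes functions of
  data that do not depend on a bound \<open>r\<close>.
\<close>

fun perm_of_code :: "nat list \<Rightarrow> nat \<Rightarrow> nat" where
  "perm_of_code [] = id"
| "perm_of_code (i # is) = ins_first i (perm_of_code is)"

fun valid_code :: "nat list \<Rightarrow> bool" where
  "valid_code [] \<longleftrightarrow> True"
| "valid_code (i # is) \<longleftrightarrow> 1 \<le> i \<and> i \<le> Suc (length is) \<and> valid_code is"

lemma perm_of_code_permutes: "valid_code is \<Longrightarrow> perm_of_code is permutes {1..length is}"
proof (induction "is")
  case (Cons i "is")
  then show ?case using ins_first_permutes[of "perm_of_code is" "length is" i] by simp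
qed (simp add: permutes_id)

text \<open>
  The equation \<open>x = lam\<close> at the end fixes the last coordinate and all coordinates outside the
  range, as the convex hull does. The merged entry \<open>lam i + lam (Suc i) - x 1\<close> is what preserves
  the coordinate sum.
\<close>

fun cube :: "nat list \<Rightarrow> (nat \<Rightarrow> real) \<Rightarrow> (nat \<Rightarrow> real) \<Rightarrow> bool" where
  "cube [] lam x \<longleftrightarrow> x = lam"
| "cube (i # is) lam x \<longleftrightarrow> lam (Suc i) \<le> x 1 \<and> x 1 \<le> lam i \<and>
     cube is (merge i (lam i + lam (Suc i) - x 1) lam) (ftail x)"

text \<open>
  All conditions are affine in the pair of \<open>lam\<close> and \<open>x\<close>. Convexity has to be proved jointly in
  both, because the sequence in the recursive call depends on \<open>x\<close>.
\<close>

lemma cube_convex: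
  assumes "cube is lam x" "cube is mu z" "0 \<le> s" "0 \<le> t"
  shows "cube is (s *\<^sub>R lam + t *\<^sub>R mu) (s *\<^sub>R x + t *\<^sub>R z)"
  using assms(1,2)
proof (induction "is" arbitrary: lam mu x z)
  case (Cons i "is")
  let ?n = "s *\<^sub>R lam + t *\<^sub>R mu" and ?v = "s *\<^sub>R x + t *\<^sub>R z"
  have "merge i (?n i + ?n (Suc i) - ?v 1) ?n =
      s *\<^sub>R merge i (lam i + lam (Suc i) - x 1) lam + t *\<^sub>R merge i (mu i + mu (Suc i) - z 1) mu"
    by (auto simp: merge_def scaleR_fun_def algebra_simps)
  moreover have "ftail ?v = s *\<^sub>R ftail x + t *\<^sub>R ftail z"
    by (auto simp: ftail_def scaleR_fun_def)
  moreover have "cube is (s *\<^sub>R merge i (lam i + lam (Suc i) - x 1) lam +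
      t *\<^sub>R merge i (mu i + mu (Suc i) - z 1) mu) (s *\<^sub>R ftail x + t *\<^sub>R ftail z)"
    using Cons.prems by (intro Cons.IH) simp_all
  ultimately have "cube is (merge i (?n i + ?n (Suc i) - ?v 1) ?n) (ftail ?v)"
    by (simp only:)
  moreover have "?n (Suc i) \<le> ?v 1" "?v 1 \<le> ?n i"
    using Cons.prems assms(3,4) by (auto simp: scaleR_fun_def intro!: add_mono mult_left_mono)
  ultimately show ?case unfolding cube.simps by (intro conjI)
qed simp

lemma convex_cube: "convex {x. cube is lam x}"
proof (rule convexI, clarify)
  fix x y and u v :: real assume "cube is lam x" "cube is lam y" "0 \<le> u" "0 \<le> v" "u + v = 1"
  then have "cube is (u *\<^sub>R lam + v *\<^sub>R lam) (u *\<^sub>R x + v *\<^sub>R y)" by (intro cube_convex)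
  moreover have "u *\<^sub>R lam + v *\<^sub>R lam = lam"
    using \<open>u + v = 1\<close> by (metis scaleR_left_distrib scaleR_one)
  ultimately show "cube is lam (u *\<^sub>R x + v *\<^sub>R y)" by simp
qed

lemma bruhat_interval_code_Cons:
  assumes "valid_code (i # is)"
  shows "bruhat_interval (Suc (length (i # is))) (perm_of_code (i # is))
      (long_cycle (length (i # is)) \<circ> perm_of_code (i # is)) =
    (\<Union>j\<in>{i, Suc i}. ins_first j ` bruhat_interval (Suc (length is)) (perm_of_code is)
       (long_cycle (length is) \<circ> perm_of_code is))"
  using bruhat_interval_ins_first[OF perm_of_code_permutes, of "is" i] assms by simp

lemma bruhat_interval_code_Nil:
  "bruhat_interval (Suc (length [])) (perm_of_code []) (long_cycle (length []) \<circ> perm_of_code []) = {id}"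
proof -
  have 1: "v permutes {1..Suc 0} \<longleftrightarrow> v = id" for v :: "nat \<Rightarrow> nat" by simp
  show ?thesis
    by (auto simp: bruhat_interval_def 1 long_cycle_def)
qed

lemma cube_vertex:
  assumes "valid_code is" "dominant (Suc (length is)) lam"
    "v \<in> bruhat_interval (Suc (length is)) (perm_of_code is) (long_cycle (length is) \<circ> perm_of_code is)"
  shows "cube is lam (lam \<circ> v)"
  using assms
proof (induction "is" arbitrary: lam v)
  case Nil
  from Nil.prems(3) have "v = id" unfolding bruhat_interval_code_Nil by blast
  then show ?case by simp
next
  case (Cons i "is")
  from Cons.prems(3) obtain j w where jw: "j = i \<or> j = Suc i" "v = ins_first j w"
    and w: "w \<in> bruhat_interval (Suc (length is)) (perm_of_code is) (long_cycle (length is) \<circ> perm_of_code is)"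
    unfolding bruhat_interval_code_Cons[OF Cons.prems(1)] by blast
  have i: "1 \<le> i" "i \<le> Suc (length is)" "valid_code is" using Cons.prems(1) by auto
  have le: "lam (Suc i) \<le> lam i" using Cons.prems(2) i by (auto simp: dominant_def)
  have IH: "cube is (merge i y lam) (merge i y lam \<circ> w)" if "lam (Suc i) \<le> y" "y \<le> lam i" for y
    using Cons.prems(2) i that by (intro Cons.IH w dominant_merge) auto
  from jw(1) show ?case
  proof
    assume "j = i"
    show ?thesis unfolding jw(2) \<open>j = i\<close>
      using IH[of "lam (Suc i)"] le
      by (simp only: comp_ins_first(1) cube.simps ftail_fcons fcons_1 add_diff_cancel_left' order_refl)
  next
    assume "j = Suc i"
    show ?thesis unfolding jw(2) \<open>j = Suc i\<close>
      using IH[of "lam i"] le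
      by (simp only: comp_ins_first(2) cube.simps ftail_fcons fcons_1 add_diff_cancel_right' order_refl)
  qed
qed

text \<open>
  Let \<open>x 1\<close> be the combination of \<open>lam i\<close> and \<open>lam (Suc i)\<close> with weights \<open>s\<close> and \<open>t\<close>. The merged
  entry is then the combination with the weights exchanged, so for each \<open>w\<close> the point with first
  coordinate \<open>x 1\<close> and tail given by \<open>w\<close> is the combination, with weights \<open>s\<close> and \<open>t\<close>, of the two
  vertices that prolong \<open>w\<close>. As a convex set contains all these points, it contains \<open>x\<close>, whose
  tail is a convex combination of the tails.
\<close>

lemma cube_subset_hull:
  assumes "valid_code is" "cube is lam x"
  shows "x \<in> convex hull ((\<lambda>v. lam \<circ> v) `
    bruhat_interval (Suc (length is)) (perm_of_code is) (long_cycle (length is) \<circ> perm_of_code is))"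
  using assms
proof (induction "is" arbitrary: lam x)
  case Nil
  from Nil.prems(2) show ?case unfolding bruhat_interval_code_Nil by (auto intro!: hull_inc)
next
  case (Cons i "is")
  let ?W = "bruhat_interval (Suc (length is)) (perm_of_code is) (long_cycle (length is) \<circ> perm_of_code is)"
  let ?V = "\<Union>j\<in>{i, Suc i}. ins_first j ` ?W"
  let ?H = "convex hull ((\<lambda>v. lam \<circ> v) ` ?V)"
  define mu where "mu = merge i (lam i + lam (Suc i) - x 1) lam"
  have x1: "lam (Suc i) \<le> x 1" "x 1 \<le> lam i" and tl: "cube is mu (ftail x)"
    using Cons.prems(2) by (simp_all add: mu_def)
  obtain s t where st: "0 \<le> s" "0 \<le> t" "s + t = 1" "x 1 = s * lam i + t * lam (Suc i)"
  proof -
    have "x 1 \<in> closed_segment (lam (Suc i)) (lam i)"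
      using x1 by (simp add: closed_segment_eq_real_ivl)
    then obtain u where "0 \<le> u" "u \<le> 1" "x 1 = (1 - u) * lam (Suc i) + u * lam i"
      by (auto simp: in_segment)
    then show thesis by (intro that[of u "1 - u"]) auto
  qed
  have V: "fcons (x 1) (mu \<circ> w) \<in> ?H" if w: "w \<in> ?W" for w
  proof -
    have "lam \<circ> ins_first i w \<in> ?H" "lam \<circ> ins_first (Suc i) w \<in> ?H"
      using w by (auto intro!: hull_inc)
    then have "s *\<^sub>R (lam \<circ> ins_first i w) + t *\<^sub>R (lam \<circ> ins_first (Suc i) w) \<in> ?H"
      using st by (intro convexD[OF convex_convex_hull])
    also have "s *\<^sub>R (lam \<circ> ins_first i w) + t *\<^sub>R (lam \<circ> ins_first (Suc i) w) = fcons (x 1) (mu \<circ> w)"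
    proof
      fix p
      have st': "s * a + t * a = a" for a
        using st(3) by (metis distrib_right mult_1)
      have y: "lam i + lam (Suc i) - x 1 = s * lam (Suc i) + t * lam i"
        using st' [of "lam i"] st'[of "lam (Suc i)"] st(4) by linarith
      show "(s *\<^sub>R (lam \<circ> ins_first i w) + t *\<^sub>R (lam \<circ> ins_first (Suc i) w)) p = fcons (x 1) (mu \<circ> w) p"
        unfolding comp_ins_first mu_def y
        using st(4) by (simp add: scaleR_fun_def fcons_def merge_def st')
    qed
    finally show ?thesis .
  qed
  have "convex {z. fcons (x 1) z \<in> ?H}"
  proof (rule convexI, clarify)
    fix y z and u v :: real
    assume yz: "fcons (x 1) y \<in> ?H" "fcons (x 1) z \<in> ?H" and uv: "0 \<le> u" "0 \<le> v" "u + v = 1"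
    have "u * x 1 + v * x 1 = x 1" using uv by (metis distrib_right mult_1)
    then have "fcons (x 1) (u *\<^sub>R y + v *\<^sub>R z) = u *\<^sub>R fcons (x 1) y + v *\<^sub>R fcons (x 1) z"
      by (auto simp: fcons_def scaleR_fun_def)
    with convexD[OF convex_convex_hull yz uv] show "fcons (x 1) (u *\<^sub>R y + v *\<^sub>R z) \<in> ?H" by simp
  qed
  with V have "convex hull ((\<lambda>v. mu \<circ> v) ` ?W) \<subseteq> {z. fcons (x 1) z \<in> ?H}"
    by (intro hull_minimal) auto
  moreover have "ftail x \<in> convex hull ((\<lambda>v. mu \<circ> v) ` ?W)"
    using Cons.prems tl by (intro Cons.IH) auto
  ultimately have "x \<in> ?H" using fcons_ftail[of x] by auto
  then show ?case unfolding bruhat_interval_code_Cons[OF Cons.prems(1)] .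
qed

lemma C_polytope_code:
  assumes "valid_code is" "dominant (Suc (length is)) lam"
  shows "C_polytope (length is) lam (perm_of_code is) = {x. cube is lam x}"
proof
  show "C_polytope (length is) lam (perm_of_code is) \<subseteq> {x. cube is lam x}"
    unfolding C_polytope_def
    by (intro hull_minimal convex_cube) (use cube_vertex[OF assms] in auto)
  show "{x. cube is lam x} \<subseteq> C_polytope (length is) lam (perm_of_code is)"
    unfolding C_polytope_def using cube_subset_hull[OF assms(1)] by auto
qed

text \<open>
  The same inequalities without the equations for the remaining coordinates: the projection that
  forgets the last coordinate.
\<close>

fun slab :: "nat list \<Rightarrow> (nat \<Rightarrow> real) \<Rightarrow> (nat \<Rightarrow> real) \<Rightarrow> bool" where
  "slab [] lam x \<longleftrightarrow> True"
| "slab (i # is) lam x \<longleftrightarrow> lam (Suc i) \<le> x 1 \<and> x 1 \<le> lam i \<and>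
     slab is (merge i (lam i + lam (Suc i) - x 1) lam) (\<lambda>p. x (Suc p))"

lemma slab_cong:
  "(\<And>p. p \<in> {1..length is} \<Longrightarrow> x p = y p) \<Longrightarrow> slab is lam x \<longleftrightarrow> slab is lam y"
proof (induction "is" arbitrary: lam x y)
  case (Cons i "is")
  have "slab is mu (\<lambda>p. x (Suc p)) = slab is mu (\<lambda>p. y (Suc p))" for mu
    using Cons.prems by (intro Cons.IH) auto
  moreover have "x 1 = y 1" using Cons.prems[of 1] by simp
  ultimately show ?case by simp
qed simp

lemma cube_imp_slab: "cube is lam x \<Longrightarrow> slab is lam x"
proof (induction "is" arbitrary: lam x)
  case (Cons i "is")
  then have "slab is (merge i (lam i + lam (Suc i) - x 1) lam) (ftail x)" by simp
  also have "slab is (merge i (lam i + lam (Suc i) - x 1) lam) (ftail x) =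
      slab is (merge i (lam i + lam (Suc i) - x 1) lam) (\<lambda>p. x (Suc p))"
    by (rule slab_cong) (simp add: ftail_def)
  finally show ?case using Cons.prems by simp
qed simp

lemma slab_imp_cube: "slab is lam z \<Longrightarrow> \<exists>x. cube is lam x \<and> (\<forall>p\<in>{1..length is}. x p = z p)"
proof (induction "is" arbitrary: lam z)
  case (Cons i "is")
  then have "slab is (merge i (lam i + lam (Suc i) - z 1) lam) (\<lambda>p. z (Suc p))" by simp
  from Cons.IH[OF this] obtain x where x: "cube is (merge i (lam i + lam (Suc i) - z 1) lam) x"
    "\<forall>p\<in>{1..length is}. x p = z (Suc p)" by auto
  have "cube (i # is) lam (fcons (z 1) x)"
    using x(1) Cons.prems by (simp add: ftail_fcons)
  moreover have "fcons (z 1) x p = z p" if "p \<in> {1..length (i # is)}" for p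
    using x(2) that by (cases p) (auto simp: fcons_def)
  ultimately show ?case by blast
qed simp

lemma restrict_image_cube:
  "(\<lambda>p. restrict p {1..length is}) ` {x. cube is lam x} =
     {z \<in> extensional {1..length is}. slab is lam z}"
proof (intro equalityI subsetI)
  fix z assume "z \<in> (\<lambda>p. restrict p {1..length is}) ` {x. cube is lam x}"
  then obtain x where x: "cube is lam x" "z = restrict x {1..length is}" by auto
  have "slab is lam z = slab is lam x" by (rule slab_cong) (simp add: x)
  with x cube_imp_slab[of "is" lam x] show "z \<in> {z \<in> extensional {1..length is}. slab is lam z}" by simp
next
  fix z assume z: "z \<in> {z \<in> extensional {1..length is}. slab is lam z}"
  then obtain x where x: "cube is lam x" "\<forall>p\<in>{1..length is}. x p = z p"
    using slab_imp_cube[of "is" lam z] by auto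
  have "z = restrict x {1..length is}"
    using z x(2) by (intro extensionalityI[of z "{1..length is}"]) auto
  with x show "z \<in> (\<lambda>p. restrict p {1..length is}) ` {x. cube is lam x}" by blast
qed

section \<open>Volumes by slicing\<close>

text \<open>
  Coordinates are numbered from \<open>s + 1\<close> on, so that slicing off the first one needs no reindexing
  of the product measure.
\<close>

definition slab_set :: "nat \<Rightarrow> nat list \<Rightarrow> (nat \<Rightarrow> real) \<Rightarrow> (nat \<Rightarrow> real) set" where
  "slab_set s is lam =
     {z \<in> space (\<Pi>\<^sub>M k\<in>{Suc s..s + length is}. lborel). slab is lam (\<lambda>p. z (p + s))}"

text \<open>
  With values in \<^typ>\<open>ennreal\<close>, the iterated integral makes sense before anything is known about
  measurability or integrability.
\<close>

fun slab_volume :: "nat list \<Rightarrow> (nat \<Rightarrow> real) \<Rightarrow> ennreal" where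
  "slab_volume [] lam = 1"
| "slab_volume (i # is) lam =
     (\<integral>\<^sup>+ y. indicator {lam (Suc i)..lam i} y * slab_volume is (merge i y lam) \<partial>lborel)"

lemma measurable_merge:
  "(\<lambda>p. merge i (snd p) (fst p)) \<in> (\<Pi>\<^sub>M k\<in>UNIV. borel) \<Otimes>\<^sub>M lborel \<rightarrow>\<^sub>M (\<Pi>\<^sub>M k\<in>UNIV. borel)"
proof (rule measurable_PiM_single')
  fix j :: nat
  consider "j < i" | "j = i" | "i < j" by linarith
  then show "(\<lambda>p. merge i (snd p) (fst p) j) \<in> borel_measurable ((\<Pi>\<^sub>M k\<in>UNIV. borel) \<Otimes>\<^sub>M lborel)"
    by cases (simp_all add: merge_def)
qed (auto simp: space_PiM)

text \<open>
  The induction needs measurability in all entries of the sequence at once, since the inner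
  integrals are taken along merged sequences.
\<close>

lemma measurable_slab_volume: "slab_volume is \<in> borel_measurable (\<Pi>\<^sub>M k\<in>UNIV. borel)"
proof (induction "is")
  case Nil
  have "slab_volume [] = (\<lambda>lam. 1)" by auto
  then show ?case by simp
next
  case (Cons i "is")
  let ?M = "(\<Pi>\<^sub>M k\<in>UNIV. borel) :: (nat \<Rightarrow> real) measure"
  have 1: "(\<lambda>p. slab_volume is (merge i (snd p) (fst p))) \<in> borel_measurable (?M \<Otimes>\<^sub>M lborel)"
    by (rule measurable_compose[OF measurable_merge Cons.IH])
  have 2: "(\<lambda>p. indicator {fst p (Suc i)..fst p i} (snd p) :: ennreal) \<in> borel_measurable (?M \<Otimes>\<^sub>M lborel)"
  proof -
    have [measurable]: "(\<lambda>p. fst p k) \<in> borel_measurable (?M \<Otimes>\<^sub>M lborel)" for k :: nat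
      by (rule measurable_compose[OF measurable_fst measurable_component_singleton]) simp
    have [measurable]: "(\<lambda>p. snd p) \<in> borel_measurable (?M \<Otimes>\<^sub>M lborel)"
      using measurable_snd[of ?M lborel] by simp
    have "(\<lambda>p. if fst p (Suc i) \<le> snd p \<and> snd p \<le> fst p i then 1 else 0 :: ennreal)
        \<in> borel_measurable (?M \<Otimes>\<^sub>M lborel)"
      by measurable
    then show ?thesis by (simp add: indicator_def of_bool_def)
  qed
  have "(\<lambda>lam. slab_volume (i # is) lam) \<in> borel_measurable ?M"
    unfolding slab_volume.simps
    by (intro lborel.borel_measurable_nn_integral)
       (use borel_measurable_times_ennreal[OF 2 1] in \<open>simp add: case_prod_unfold\<close>)
  then show ?case by simp
qed

lemma measurable_slab_volume_merge: "(\<lambda>y. slab_volume is (merge i y lam)) \<in> borel_measurable lborel"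
proof -
  have "(\<lambda>y. merge i y lam) \<in> lborel \<rightarrow>\<^sub>M (\<Pi>\<^sub>M k\<in>UNIV. borel)"
  proof (rule measurable_PiM_single')
    fix j :: nat
    consider "j < i" | "j = i" | "i < j" by linarith
    then show "(\<lambda>y. merge i y lam j) \<in> borel_measurable lborel"
      by cases (simp_all add: merge_def)
  qed (auto simp: space_PiM)
  from measurable_compose[OF this measurable_slab_volume] show ?thesis .
qed

text \<open>
  Both the sequence and the point are allowed to depend on a parameter, because the recursive
  call passes a sequence that depends on the point.
\<close>

lemma measurable_slab:
  assumes "\<And>j. (\<lambda>w. L w j) \<in> borel_measurable M"
    and "\<And>p. p \<in> {1..length is} \<Longrightarrow> (\<lambda>w. X w p) \<in> borel_measurable M"
  shows "{w \<in> space M. slab is (L w) (X w)} \<in> sets M"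
  using assms
proof (induction "is" arbitrary: L X)
  case (Cons i "is")
  let ?L = "\<lambda>w. merge i (L w i + L w (Suc i) - X w 1) (L w)"
  note [measurable] = Cons.prems(1) Cons.prems(2)[of 1, simplified]
  have "{w \<in> space M. slab is (?L w) (\<lambda>p. X w (Suc p))} \<in> sets M"
  proof (rule Cons.IH)
    fix j
    consider "j < i" | "j = i" | "i < j" by linarith
    then show "(\<lambda>w. ?L w j) \<in> borel_measurable M"
      by cases (simp_all add: merge_def)
  qed (use Cons.prems in auto)
  then have "{w \<in> space M. L w (Suc i) \<le> X w 1} \<inter> {w \<in> space M. X w 1 \<le> L w i} \<inter>
      {w \<in> space M. slab is (?L w) (\<lambda>p. X w (Suc p))} \<in> sets M"
    by simp
  also have "{w \<in> space M. L w (Suc i) \<le> X w 1} \<inter> {w \<in> space M. X w 1 \<le> L w i} \<inter>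
      {w \<in> space M. slab is (?L w) (\<lambda>p. X w (Suc p))} = {w \<in> space M. slab (i # is) (L w) (X w)}"
    by auto
  finally show ?case .
qed simp

lemma slab_set_sets: "slab_set s is lam \<in> sets (\<Pi>\<^sub>M k\<in>{Suc s..s + length is}. lborel)"
  unfolding slab_set_def by (rule measurable_slab) auto

lemma emeasure_slab_set:
  "emeasure (\<Pi>\<^sub>M k\<in>{Suc s..s + length is}. lborel) (slab_set s is lam) = slab_volume is lam"
proof (induction "is" arbitrary: s lam)
  case Nil
  interpret product_sigma_finite "\<lambda>k :: nat. lborel :: real measure" ..
  show ?case by (simp add: slab_set_def space_PiM emeasure_PiM_empty PiM_empty)
next
  case (Cons i "is")
  interpret product_sigma_finite "\<lambda>k :: nat. lborel :: real measure" ..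
  let ?I = "{Suc (Suc s)..Suc s + length is}"
  let ?a = "lam i" and ?b = "lam (Suc i)"
  let ?S = "slab_set s (i # is) lam"
  have ins: "{Suc s..s + length (i # is)} = insert (Suc s) ?I" by auto
  have S: "?S \<in> sets (\<Pi>\<^sub>M k\<in>insert (Suc s) ?I. lborel)"
    using slab_set_sets[of s "i # is" lam] unfolding ins .
  have upd: "indicator ?S (z(Suc s := y)) = (indicator {?b..?a} y :: ennreal) *
      indicator (slab_set (Suc s) is (merge i (?a + ?b - y) lam)) z"
    if z: "z \<in> space (\<Pi>\<^sub>M k\<in>?I. lborel)" for y z
  proof -
    have sp: "z(Suc s := y) \<in> space (\<Pi>\<^sub>M k\<in>insert (Suc s) ?I. lborel)"
      using z by (auto simp: space_PiM PiE_def extensional_def)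
    have "slab is mu (\<lambda>p. (z(Suc s := y)) (Suc p + s)) = slab is mu (\<lambda>p. z (p + Suc s))" for mu
      by (rule slab_cong) auto
    then have "z(Suc s := y) \<in> ?S \<longleftrightarrow> y \<in> {?b..?a} \<and> z \<in> slab_set (Suc s) is (merge i (?a + ?b - y) lam)"
      unfolding slab_set_def ins using sp z by auto
    then show ?thesis by (simp add: indicator_def)
  qed
  \<comment> \<open>Fubini with the first coordinate outside: its slices are the slabs for the merged sequence\<close>
  have "emeasure (\<Pi>\<^sub>M k\<in>insert (Suc s) ?I. lborel) ?S =
      (\<integral>\<^sup>+ x. indicator ?S x \<partial>(\<Pi>\<^sub>M k\<in>insert (Suc s) ?I. lborel))"
    using S by simp
  also have "\<dots> = (\<integral>\<^sup>+ y. (\<integral>\<^sup>+ z. indicator ?S (z(Suc s := y)) \<partial>(\<Pi>\<^sub>M k\<in>?I. lborel)) \<partial>lborel)"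
    using S by (intro product_nn_integral_insert_rev) auto
  also have "\<dots> = (\<integral>\<^sup>+ y. indicator {?b..?a} y * slab_volume is (merge i (?a + ?b - y) lam) \<partial>lborel)"
  proof (rule nn_integral_cong)
    fix y :: real
    let ?T = "slab_set (Suc s) is (merge i (?a + ?b - y) lam)"
    have "(\<integral>\<^sup>+ z. indicator ?S (z(Suc s := y)) \<partial>(\<Pi>\<^sub>M k\<in>?I. lborel)) =
        (\<integral>\<^sup>+ z. indicator {?b..?a} y * indicator ?T z \<partial>(\<Pi>\<^sub>M k\<in>?I. lborel))"
      by (rule nn_integral_cong) (rule upd)
    also have "\<dots> = indicator {?b..?a} y * emeasure (\<Pi>\<^sub>M k\<in>?I. lborel) ?T"
      using slab_set_sets[of "Suc s" "is"] by (intro nn_integral_cmult_indicator) simp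
    finally show "(\<integral>\<^sup>+ z. indicator ?S (z(Suc s := y)) \<partial>(\<Pi>\<^sub>M k\<in>?I. lborel)) =
        indicator {?b..?a} y * slab_volume is (merge i (?a + ?b - y) lam)"
      using Cons.IH[of "Suc s"] by simp
  qed
  also have "\<dots> = slab_volume (i # is) lam"
  proof -
    \<comment> \<open>the slice over \<open>y\<close> carries the merged entry \<open>?a + ?b - y\<close>; reflect the interval\<close>
    have "slab_volume (i # is) lam = \<bar>-1::real\<bar> * (\<integral>\<^sup>+ y. indicator {?b..?a} (?a + ?b + (-1) * y) *
        slab_volume is (merge i (?a + ?b + (-1) * y) lam) \<partial>lborel)"
      unfolding slab_volume.simps
      by (rule nn_integral_real_affine) (use measurable_slab_volume_merge in auto)
    also have "\<dots> = (\<integral>\<^sup>+ y. indicator {?b..?a} y * slab_volume is (merge i (?a + ?b - y) lam) \<partial>lborel)"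
      by (auto intro!: nn_integral_cong simp: indicator_def)
    finally show ?thesis by simp
  qed
  finally show ?case unfolding ins .
qed

text \<open>
  A crude bound, which serves only to know that the volumes are finite: every entry stays in the
  interval from \<open>-B\<close> to \<open>B\<close>, so every integration range has length at most \<open>2 * B\<close>.
\<close>

lemma slab_volume_le:
  assumes "valid_code is" "\<And>j. j \<in> {1..Suc (length is)} \<Longrightarrow> \<bar>lam j\<bar> \<le> B"
  shows "slab_volume is lam \<le> ennreal ((2 * B) ^ length is)"
  using assms
proof (induction "is" arbitrary: lam)
  case (Cons i "is")
  have i: "1 \<le> i" "i \<le> Suc (length is)" "valid_code is" using Cons.prems(1) by auto
  have B: "\<bar>lam i\<bar> \<le> B" "\<bar>lam (Suc i)\<bar> \<le> B" using Cons.prems(2) i by auto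
  have "slab_volume (i # is) lam \<le> (\<integral>\<^sup>+ y. ennreal ((2 * B) ^ length is) * indicator {lam (Suc i)..lam i} y \<partial>lborel)"
    unfolding slab_volume.simps
  proof (rule nn_integral_mono)
    fix y :: real
    show "indicator {lam (Suc i)..lam i} y * slab_volume is (merge i y lam)
      \<le> ennreal ((2 * B) ^ length is) * indicator {lam (Suc i)..lam i} y"
    proof (cases "y \<in> {lam (Suc i)..lam i}")
      case True
      then have "\<bar>y\<bar> \<le> B" using B by auto
      then have "slab_volume is (merge i y lam) \<le> ennreal ((2 * B) ^ length is)"
        using Cons.prems(2) i by (intro Cons.IH) (auto simp: merge_def)
      then show ?thesis using True by simp
    qed simp
  qed
  also have "\<dots> = ennreal ((2 * B) ^ length is) * emeasure lborel {lam (Suc i)..lam i}"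
    by (simp add: nn_integral_cmult_indicator)
  also have "\<dots> \<le> ennreal ((2 * B) ^ length is) * ennreal (2 * B)"
    using B by (intro mult_left_mono) (auto simp: emeasure_lborel_Icc_eq intro!: ennreal_leI)
  also have "\<dots> = ennreal ((2 * B) ^ length (i # is))"
    using B by (subst ennreal_mult[symmetric]) (auto simp: mult_ac)
  finally show ?case .
qed simp

lemma slab_volume_finite:
  assumes "valid_code is"
  shows "slab_volume is lam < \<infinity>"
proof -
  have "slab_volume is lam \<le> ennreal ((2 * (\<Sum>j\<in>{1..Suc (length is)}. \<bar>lam j\<bar>)) ^ length is)"
    by (rule slab_volume_le[OF assms]) (rule member_le_sum, auto)
  then show ?thesis unfolding infinity_ennreal_def by (rule le_less_trans) (rule ennreal_less_top)
qed

lemma proj_vol_code: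
  assumes "valid_code is" "dominant (Suc (length is)) lam"
  shows "proj_vol (length is) (C_polytope (length is) lam (perm_of_code is)) = enn2real (slab_volume is lam)"
proof -
  have "slab_set 0 is lam = {z \<in> extensional {1..length is}. slab is lam z}"
    by (simp add: slab_set_def space_PiM PiE_def)
  then show ?thesis
    unfolding proj_vol_def C_polytope_code[OF assms] restrict_image_cube measure_def
    using emeasure_slab_set[of 0 "is" lam] by simp
qed

lemma slab_volume_Cons_has_integral:
  assumes "valid_code (i # is)"
  shows "((\<lambda>y. enn2real (slab_volume is (merge i y lam))) has_integral enn2real (slab_volume (i # is) lam)) {lam (Suc i)..lam i}"
proof -
  let ?f = "\<lambda>y. indicator {lam (Suc i)..lam i} y * enn2real (slab_volume is (merge i y lam))"
  have [measurable]: "(\<lambda>y. slab_volume is (merge i y lam)) \<in> borel_measurable lborel"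
    by (rule measurable_slab_volume_merge)
  have v: "valid_code is" using assms by simp
  have f: "slab_volume (i # is) lam = (\<integral>\<^sup>+ y. ennreal (?f y) \<partial>lborel)"
    unfolding slab_volume.simps using slab_volume_finite[OF v]
    by (intro nn_integral_cong) (auto simp: indicator_def)
  have "integrable lborel ?f" "integral\<^sup>L lborel ?f = enn2real (slab_volume (i # is) lam)"
  proof -
    have *: "(\<integral>\<^sup>+ y. ennreal (?f y) \<partial>lborel) = ennreal (enn2real (slab_volume (i # is) lam))"
      using slab_volume_finite[OF assms, of lam] f by simp
    show "integrable lborel ?f"
      by (rule integrableI_nn_integral_finite[OF _ _ *]) auto
    show "integral\<^sup>L lborel ?f = enn2real (slab_volume (i # is) lam)"
      unfolding f by (rule integral_eq_nn_integral) auto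
  qed
  from has_integral_integral_lborel[OF this(1)] this(2)
  have "(?f has_integral enn2real (slab_volume (i # is) lam)) UNIV" by simp
  also have "?f = (\<lambda>y. if y \<in> {lam (Suc i)..lam i} then enn2real (slab_volume is (merge i y lam)) else 0)"
    by (auto simp: indicator_def)
  finally show ?thesis by (simp only: has_integral_restrict_UNIV)
qed

lemma permutes_codeE:
  assumes "w permutes {1..r}"
  obtains "is" where "valid_code is" "length is = r" "perm_of_code is = w"
proof -
  have "\<exists>is. valid_code is \<and> length is = r \<and> perm_of_code is = w"
    using assms
  proof (induction r arbitrary: w)
    case 0
    then show ?case by (intro exI[of _ "[]"]) simp
  next
    case (Suc r)
    obtain j v where jv: "j \<in> {1..Suc r}" "v permutes {1..r}" "w = ins_first j v"
      using permutes_ins_firstE[OF Suc.prems] by blast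
    obtain "is" where "valid_code is \<and> length is = r \<and> perm_of_code is = v"
      using Suc.IH[OF jv(2)] by blast
    with jv show ?case by (intro exI[of _ "j # is"]) simp
  qed
  with that show thesis by blast
qed

lemma proj_vol_C_polytope_0: "proj_vol 0 (C_polytope 0 lam id) = 1"
proof -
  have "dominant (Suc (length [])) lam" by (auto simp: dominant_def dest: le_antisym)
  from proj_vol_code[OF _ this] show ?thesis by simp
qed

lemma proj_vol_C_polytope_ins_first:
  assumes w: "w permutes {1..r}" and i: "i \<in> {1..Suc r}" and lam: "dominant (Suc (Suc r)) lam"
  shows "((\<lambda>y. proj_vol r (C_polytope r (merge i y lam) w)) has_integral
     proj_vol (Suc r) (C_polytope (Suc r) lam (ins_first i w))) {lam (Suc i)..lam i}"
proof -
  from w obtain "is" where c: "valid_code is" "length is = r" "perm_of_code is = w"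
    by (rule permutes_codeE)
  have c': "valid_code (i # is)" using c i by simp
  have 1: "proj_vol (Suc r) (C_polytope (Suc r) lam (ins_first i w)) = enn2real (slab_volume (i # is) lam)"
    using proj_vol_code[OF c', of lam] c lam by simp
  have 2: "enn2real (slab_volume is (merge i y lam)) = proj_vol r (C_polytope r (merge i y lam) w)"
    if "y \<in> {lam (Suc i)..lam i}" for y
    using proj_vol_code[OF c(1), of "merge i y lam"] c dominant_merge[OF lam, of i y] i that by simp
  show ?thesis
    unfolding 1 by (rule has_integral_eq[OF _ slab_volume_Cons_has_integral[OF c']]) (use 2 in simp)
qed

section \<open>The symmetrization at a point with a zero coordinate\<close>

text \<open>
  The product of all factors is the quotient of \<open>\<Prod>(q z\<^sub>i - z\<^sub>j)\<close> over nonadjacent pairs by the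
  Vandermonde product, see \<open>q_kernel_quotient\<close>. A factor \<open>1\<close> for \<open>i \<ge> j\<close> allows both indices to
  run over the full range.
\<close>

definition q_kernel_factor :: "real \<Rightarrow> (nat \<Rightarrow> real) \<Rightarrow> nat \<Rightarrow> nat \<Rightarrow> real" where
  "q_kernel_factor q z i j =
     (if i < j then (if Suc i < j then (q * z i - z j) / (z i - z j) else 1 / (z i - z j)) else 1)"

definition q_kernel :: "real \<Rightarrow> nat \<Rightarrow> (nat \<Rightarrow> real) \<Rightarrow> real" where
  "q_kernel q n z = (\<Prod>i\<in>{1..n}. \<Prod>j\<in>{1..n}. q_kernel_factor q z i j)"

definition linear_form :: "nat \<Rightarrow> (nat \<Rightarrow> real) \<Rightarrow> (nat \<Rightarrow> real) \<Rightarrow> real" where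
  "linear_form n lam z = (\<Sum>j\<in>{1..n}. lam j * z j)"

text \<open>
  The \<open>q\<close>-volume as a rational function, evaluated at a real \<open>q\<close> and a real point \<open>X\<close>. The sign in
  \<open>\<partial>\<close> has been absorbed by permuting the Vandermonde denominator as well.
\<close>

definition volume_at :: "real \<Rightarrow> nat \<Rightarrow> (nat \<Rightarrow> real) \<Rightarrow> (nat \<Rightarrow> real) \<Rightarrow> real" where
  "volume_at q n lam X =
     (\<Sum>\<sigma> | \<sigma> permutes {1..n}. q_kernel q n (X \<circ> \<sigma>) * linear_form n lam (X \<circ> \<sigma>) ^ (n - 1) / fact (n - 1))"

lemma q_kernel_cong: "(\<And>j. j \<in> {1..n} \<Longrightarrow> z j = z' j) \<Longrightarrow> q_kernel q n z = q_kernel q n z'"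
  unfolding q_kernel_def by (intro prod.cong refl) (simp add: q_kernel_factor_def)

text \<open>
  With \<open>z k = 0\<close>, a nonadjacent pair whose first member is \<open>k\<close> contributes \<open>1\<close>, one whose second
  member is \<open>k\<close> contributes \<open>q\<close>, and the two adjacent pairs contribute \<open>1 / t (k - 1)\<close> and
  \<open>- 1 / t k\<close>. Deleting position \<open>k\<close> makes \<open>k - 1\<close> and its successor adjacent, so their numerator
  \<open>q * t (k - 1) - t k\<close> is left over. Its product with the two reciprocals is a difference of two terms, each
  with a single reciprocal; at the ends \<open>k = 1\<close> and \<open>k = n + 1\<close> only one of the two is present.
\<close>

lemma q_kernel_zero:
  assumes k: "1 \<le> k" "k \<le> Suc n" and n: "1 \<le> n" and z: "z k = 0"
    and t: "\<And>j. t j = z (skip k j)" and nz: "\<And>j. j \<in> {1..n} \<Longrightarrow> t j \<noteq> 0"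
  shows "q_kernel q (Suc n) z = q_kernel q n t *
    ((if 2 \<le> k then q ^ (k - 2) / t (k - 1) else 0) - (if k \<le> n then q ^ (k - 1) / t k else 0))"
proof -
  have A: "(\<Prod>j\<in>{1..n}. q_kernel_factor q z k (skip k j)) = (if k \<le> n then - 1 / t k else 1)"
  proof -
    have "q_kernel_factor q z k (skip k j) = (if j = k then - 1 / t k else 1)" if "j \<in> {1..n}" for j
      using nz[OF that] by (auto simp: q_kernel_factor_def t z skip_def divide_simps)
    then have "(\<Prod>j\<in>{1..n}. q_kernel_factor q z k (skip k j)) = (\<Prod>j\<in>{1..n}. if j = k then - 1 / t k else 1)"
      by simp
    also have "\<dots> = (if k \<le> n then - 1 / t k else 1)"
      using k by (subst prod.delta) auto
    finally show ?thesis .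
  qed
  have B: "(\<Prod>i\<in>{1..n}. q_kernel_factor q z (skip k i) k) = (if 2 \<le> k then q ^ (k - 2) / t (k - 1) else 1)"
  proof -
    have "q_kernel_factor q z (skip k i) k = (if Suc i < k then q else 1) * (if i = k - 1 then 1 / t (k - 1) else 1)"
      if "i \<in> {1..n}" for i
      using nz[OF that] that by (auto simp: q_kernel_factor_def t z skip_def)
    then have "(\<Prod>i\<in>{1..n}. q_kernel_factor q z (skip k i) k) =
        (\<Prod>i\<in>{1..n}. if Suc i < k then q else 1) * (\<Prod>i\<in>{1..n}. if i = k - 1 then 1 / t (k - 1) else 1)"
      by (simp add: prod.distrib)
    also have "(\<Prod>i\<in>{1..n}. if i = k - 1 then 1 / t (k - 1) else 1) = (if 2 \<le> k then 1 / t (k - 1) else 1)"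
      using k by (subst prod.delta) auto
    also have "(\<Prod>i\<in>{1..n}. if Suc i < k then q else 1) = q ^ card {i\<in>{1..n}. Suc i < k}"
      by (subst prod.inter_filter[symmetric]) simp_all
    also have "{i\<in>{1..n}. Suc i < k} = {1..<k - 1}" using k by auto
    finally show ?thesis by (auto simp: numeral_2_eq_2)
  qed
  have C: "(\<Prod>i\<in>{1..n}. \<Prod>j\<in>{1..n}. q_kernel_factor q z (skip k i) (skip k j)) =
      q_kernel q n t * (if 2 \<le> k \<and> k \<le> n then q * t (k - 1) - t k else 1)"
  proof -
    have "q_kernel_factor q z (skip k i) (skip k j) =
        q_kernel_factor q t i j * (if i = k - 1 then (if j = k then q * t (k - 1) - t k else 1) else 1)"
      if "i \<in> {1..n}" "j \<in> {1..n}" for i j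
    proof (cases "i = k - 1 \<and> j = k")
      case True
      then have "skip k i = i" "skip k j = Suc j" "i < j" "Suc i = j" using that by (auto simp: skip_def)
      then show ?thesis using True by (simp add: q_kernel_factor_def t)
    next
      case False
      then have "Suc (skip k i) < skip k j \<longleftrightarrow> Suc i < j" using that k by (auto simp: skip_def)
      then show ?thesis using False by (auto simp: q_kernel_factor_def t)
    qed
    then have "(\<Prod>i\<in>{1..n}. \<Prod>j\<in>{1..n}. q_kernel_factor q z (skip k i) (skip k j)) =
       (\<Prod>i\<in>{1..n}. \<Prod>j\<in>{1..n}. q_kernel_factor q t i j * (if i = k - 1 then (if j = k then q * t (k - 1) - t k else 1) else 1))"
      by simp
    also have "\<dots> = q_kernel q n t *
       (\<Prod>i\<in>{1..n}. \<Prod>j\<in>{1..n}. if i = k - 1 then (if j = k then q * t (k - 1) - t k else 1) else 1)"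
      by (simp add: prod.distrib q_kernel_def)
    also have "(\<Prod>i\<in>{1..n}. \<Prod>j\<in>{1..n}. if i = k - 1 then (if j = k then q * t (k - 1) - t k else 1) else 1) =
        (\<Prod>i\<in>{1..n}. if i = k - 1 then (\<Prod>j\<in>{1..n}. if j = k then q * t (k - 1) - t k else 1) else 1)"
      by (intro prod.cong) auto
    also have "\<dots> = (if 2 \<le> k \<and> k \<le> n then q * t (k - 1) - t k else 1)"
      using k by (simp only: prod.delta finite_atLeastAtMost) auto
    finally show ?thesis .
  qed
  have "q_kernel q (Suc n) z = (q_kernel_factor q z k k * (\<Prod>j\<in>{1..n}. q_kernel_factor q z k (skip k j))) *
      (\<Prod>i\<in>{1..n}. q_kernel_factor q z (skip k i) k * (\<Prod>j\<in>{1..n}. q_kernel_factor q z (skip k i) (skip k j)))"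
    unfolding q_kernel_def by (simp only: prod.split_skip[OF k])
  also have "\<dots> = (\<Prod>j\<in>{1..n}. q_kernel_factor q z k (skip k j)) *
      (\<Prod>i\<in>{1..n}. q_kernel_factor q z (skip k i) k) *
      (\<Prod>i\<in>{1..n}. \<Prod>j\<in>{1..n}. q_kernel_factor q z (skip k i) (skip k j))"
    by (simp add: prod.distrib q_kernel_factor_def)
  also have "\<dots> = (if k \<le> n then - 1 / t k else 1) * (if 2 \<le> k then q ^ (k - 2) / t (k - 1) else 1) *
     (q_kernel q n t * (if 2 \<le> k \<and> k \<le> n then q * t (k - 1) - t k else 1))"
    unfolding A B C ..
  also have "\<dots> = q_kernel q n t * ((if k \<le> n then - 1 / t k else 1) * (if 2 \<le> k then q ^ (k - 2) / t (k - 1) else 1) *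
      (if 2 \<le> k \<and> k \<le> n then q * t (k - 1) - t k else 1))"
    by (simp only: mult_ac)
  also have "(if k \<le> n then - 1 / t k else 1) * (if 2 \<le> k then q ^ (k - 2) / t (k - 1) else 1) *
      (if 2 \<le> k \<and> k \<le> n then q * t (k - 1) - t k else 1) =
      (if 2 \<le> k then q ^ (k - 2) / t (k - 1) else 0) - (if k \<le> n then q ^ (k - 1) / t k else 0)"
  proof -
    consider "k = 1" | "2 \<le> k" "k \<le> n" | "2 \<le> k" "k = Suc n" using k by linarith
    then show ?thesis
    proof cases
      case 1
      then show ?thesis using n by simp
    next
      case 2
      then have "t k \<noteq> 0" "t (k - 1) \<noteq> 0" by (auto intro!: nz)
      moreover have "q ^ (k - 1) = q * q ^ (k - 2)" using 2 by (metis Suc_diff_le diff_Suc_Suc numeral_2_eq_2 power_Suc One_nat_def)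
      ultimately show ?thesis using 2 by (simp add: field_simps)
    next
      case 3
      then show ?thesis by simp
    qed
  qed
  finally show ?thesis .
qed

lemma inv_ins_first:
  assumes w: "w permutes {1..n}" and k: "1 \<le> k" "k \<le> Suc n"
  shows "inv (ins_first k w) k = 1"
    and "j \<in> {1..n} \<Longrightarrow> inv (ins_first k w) (skip k j) = Suc (inv w j)"
proof -
  have p: "ins_first k w permutes {1..Suc n}" by (rule ins_first_permutes[OF w k])
  have inj: "inj (ins_first k w)" using permutes_inj[OF p] .
  show "inv (ins_first k w) k = 1"
    using inv_f_f[OF inj, of 1] by simp
  assume "j \<in> {1..n}"
  then have "inv w j \<in> {1..n}" using permutes_in_image[OF permutes_inv[OF w]] by blast
  then have "ins_first k w (Suc (inv w j)) = skip k j"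
    using permutes_inverses(1)[OF w] by simp
  then show "inv (ins_first k w) (skip k j) = Suc (inv w j)"
    using inv_f_f[OF inj, of "Suc (inv w j)"] by simp
qed

text \<open>
  Group the permutations by the position \<open>k\<close> of the zero coordinate. By \<open>q_kernel_zero\<close> each
  group carries two coefficients, one with \<open>1 / Y (\<tau> (k - 1))\<close> and one with \<open>1 / Y (\<tau> k)\<close>. Collecting
  equal reciprocals pairs the linear form that omits \<open>lam k\<close> with the one that omits
  \<open>lam (Suc k)\<close>; both are values of the form for the merged sequence, at the two ends of the
  range of the merged entry.
\<close>

lemma volume_at_Suc:
  assumes n: "1 \<le> n" and X: "X 1 = 0" "inj_on X {1..Suc n}"
  defines "Y \<equiv> \<lambda>j. X (Suc j)"
  shows "volume_at q (Suc n) lam X =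
    (\<Sum>k=1..n. q ^ (k - 1) * (\<Sum>\<tau> | \<tau> permutes {1..n}. q_kernel q n (Y \<circ> \<tau>) *
       ((linear_form n (merge k (lam k) lam) (Y \<circ> \<tau>) ^ n - linear_form n (merge k (lam (Suc k)) lam) (Y \<circ> \<tau>) ^ n) /
         (fact n * Y (\<tau> k)))))"
proof -
  have Y0: "Y j \<noteq> 0" if "j \<in> {1..n}" for j
    using X that inj_onD[OF X(2), of "Suc j" 1] by (auto simp: Y_def)
  define c where "c k t = (if 2 \<le> k then q ^ (k - 2) / t (k - 1) else 0) -
      (if k \<le> n then q ^ (k - 1) / t k else 0 :: real)" for k and t :: "nat \<Rightarrow> real"
  define P where "P k t = linear_form n (\<lambda>j. lam (skip k j)) t ^ n / fact n" for k t
  let ?F = "\<lambda>\<sigma>. q_kernel q (Suc n) (X \<circ> \<sigma>) * linear_form (Suc n) lam (X \<circ> \<sigma>) ^ n / fact n"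
  have F: "?F (inv (ins_first k w)) = q_kernel q n (Y \<circ> inv w) * c k (Y \<circ> inv w) * P k (Y \<circ> inv w)"
    if k: "1 \<le> k" "k \<le> Suc n" and w: "w permutes {1..n}" for k w
  proof -
    let ?z = "X \<circ> inv (ins_first k w)"
    have zk: "?z k = 0" using inv_ins_first(1)[OF w k] X(1) by simp
    have zs: "?z (skip k j) = (Y \<circ> inv w) j" if "j \<in> {1..n}" for j
      using inv_ins_first(2)[OF w k that] by (simp add: Y_def)
    have "q_kernel q (Suc n) ?z = q_kernel q n (\<lambda>j. ?z (skip k j)) * c k (\<lambda>j. ?z (skip k j))"
      unfolding c_def
    proof (rule q_kernel_zero[where z = ?z and t = "\<lambda>j. ?z (skip k j)", OF k n zk])
      fix j assume j: "j \<in> {1..n}"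
      then have "inv w j \<in> {1..n}" using permutes_in_image[OF permutes_inv[OF w]] by blast
      then show "?z (skip k j) \<noteq> 0" unfolding zs[OF j] using Y0 by simp
    qed (rule refl)
    also have "q_kernel q n (\<lambda>j. ?z (skip k j)) = q_kernel q n (Y \<circ> inv w)"
      by (rule q_kernel_cong) (rule zs)
    also have "c k (\<lambda>j. ?z (skip k j)) = c k (Y \<circ> inv w)"
    proof -
      have "2 \<le> k \<Longrightarrow> ?z (skip k (k - 1)) = (Y \<circ> inv w) (k - 1)" using k by (intro zs) auto
      moreover have "k \<le> n \<Longrightarrow> ?z (skip k k) = (Y \<circ> inv w) k" using k by (intro zs) auto
      ultimately show ?thesis
        unfolding c_def by (intro arg_cong2[where f = "(-)"] if_cong refl arg_cong2[where f = "(/)"])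
    qed
    finally have 1: "q_kernel q (Suc n) ?z = q_kernel q n (Y \<circ> inv w) * c k (Y \<circ> inv w)" .
    have "linear_form (Suc n) lam ?z = (\<Sum>j\<in>{1..n}. lam (skip k j) * ?z (skip k j))"
      unfolding linear_form_def sum.split_skip[OF k] using zk by simp
    also have "\<dots> = linear_form n (\<lambda>j. lam (skip k j)) (Y \<circ> inv w)"
      unfolding linear_form_def using zs by (intro sum.cong) simp_all
    finally show ?thesis using 1 by (simp add: P_def)
  qed
  \<comment> \<open>prepending \<open>k\<close> fixes the value at position \<open>1\<close>; its inverse fixes the position of value \<open>1\<close>\<close>
  have "volume_at q (Suc n) lam X = (\<Sum>\<sigma> | \<sigma> permutes {1..Suc n}. ?F \<sigma>)"
    by (simp add: volume_at_def)
  also have "\<dots> = (\<Sum>\<sigma> | \<sigma> permutes {1..Suc n}. ?F (inv \<sigma>))"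
    by (rule sum_permutations_inverse)
  also have "\<dots> = (\<Sum>k=1..Suc n. \<Sum>w | w permutes {1..n}. ?F (inv (ins_first k w)))"
    by (rule sum_permutes_ins_first)
  also have "\<dots> = (\<Sum>k=1..Suc n. \<Sum>w | w permutes {1..n}. q_kernel q n (Y \<circ> inv w) * c k (Y \<circ> inv w) * P k (Y \<circ> inv w))"
    by (intro sum.cong refl F) auto
  also have "\<dots> = (\<Sum>k=1..Suc n. \<Sum>w | w permutes {1..n}. q_kernel q n (Y \<circ> w) * c k (Y \<circ> w) * P k (Y \<circ> w))"
    by (intro sum.cong refl sum_permutations_inverse[symmetric, where f = "\<lambda>w. q_kernel q n (Y \<circ> w) * c _ (Y \<circ> w) * P _ (Y \<circ> w)"])
  also have "\<dots> = (\<Sum>w | w permutes {1..n}. q_kernel q n (Y \<circ> w) * (\<Sum>k=1..Suc n. c k (Y \<circ> w) * P k (Y \<circ> w)))"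
    by (subst sum.swap) (simp only: sum_distrib_left mult.assoc)
  also have "\<dots> = (\<Sum>w | w permutes {1..n}. q_kernel q n (Y \<circ> w) *
      (\<Sum>k=1..n. q ^ (k - 1) / Y (w k) * (P (Suc k) (Y \<circ> w) - P k (Y \<circ> w))))"
  proof (rule sum.cong[OF refl], rule arg_cong2[where f = "(*)", OF refl])
    fix w assume "w \<in> {w. w permutes {1..n}}"
    let ?t = "Y \<circ> w"
    have "(\<Sum>k=1..Suc n. c k ?t * P k ?t) =
        (\<Sum>k=1..Suc n. (if 2 \<le> k then q ^ (k - 2) / ?t (k - 1) * P k ?t else 0)) -
        (\<Sum>k=1..Suc n. (if k \<le> n then q ^ (k - 1) / ?t k * P k ?t else 0))"
      unfolding sum_subtractf[symmetric] by (intro sum.cong refl) (simp add: c_def left_diff_distrib)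
    also have "(\<Sum>k=1..Suc n. (if k \<le> n then q ^ (k - 1) / ?t k * P k ?t else 0)) =
        (\<Sum>k=1..n. q ^ (k - 1) / ?t k * P k ?t)"
      by (simp add: sum.cl_ivl_Suc)
    also have "(\<Sum>k=1..Suc n. (if 2 \<le> k then q ^ (k - 2) / ?t (k - 1) * P k ?t else 0)) =
        (\<Sum>k=1..n. q ^ (k - 1) / ?t k * P (Suc k) ?t)"
    proof -
      show ?thesis unfolding sum.split_head by (auto simp: numeral_2_eq_2 intro!: sum.cong)
    qed
    finally show "(\<Sum>k=1..Suc n. c k ?t * P k ?t) =
        (\<Sum>k=1..n. q ^ (k - 1) / Y (w k) * (P (Suc k) ?t - P k ?t))"
      by (simp only: sum_subtractf[symmetric] right_diff_distrib[symmetric] comp_def)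
  qed
  also have "\<dots> = (\<Sum>k=1..n. q ^ (k - 1) * (\<Sum>\<tau> | \<tau> permutes {1..n}. q_kernel q n (Y \<circ> \<tau>) *
       ((linear_form n (merge k (lam k) lam) (Y \<circ> \<tau>) ^ n - linear_form n (merge k (lam (Suc k)) lam) (Y \<circ> \<tau>) ^ n) /
         (fact n * Y (\<tau> k)))))"
  proof -
    have "(\<lambda>j. lam (skip (Suc k) j)) = merge k (lam k) lam"
      "(\<lambda>j. lam (skip k j)) = merge k (lam (Suc k)) lam" for k
      by (auto simp: merge_upper merge_lower)
    then have P: "P (Suc k) t = linear_form n (merge k (lam k) lam) t ^ n / fact n"
      "P k t = linear_form n (merge k (lam (Suc k)) lam) t ^ n / fact n" for k t
      unfolding P_def by simp_all
    show ?thesis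
      unfolding P(1) unfolding P(2) sum_distrib_left
      by (subst sum.swap) (intro sum.cong refl, simp add: diff_divide_distrib[symmetric] mult_ac)
  qed
  finally show ?thesis .
qed

lemma has_integral_linear_form_power:
  assumes k: "k \<in> {1..n}" and t: "t k \<noteq> 0" and le: "b \<le> a"
  shows "((\<lambda>y. linear_form n (merge k y lam) t ^ m / fact m) has_integral
    (linear_form n (merge k a lam) t ^ Suc m - linear_form n (merge k b lam) t ^ Suc m) / (fact (Suc m) * t k)) {b..a}"
proof -
  define c where "c = (\<Sum>j\<in>{1..n} - {k}. merge k 0 lam j * t j)"
  have L: "linear_form n (merge k y lam) t = c + y * t k" for y
  proof -
    have "linear_form n (merge k y lam) t = merge k y lam k * t k + (\<Sum>j\<in>{1..n} - {k}. merge k y lam j * t j)"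
      unfolding linear_form_def using k by (intro sum.remove) auto
    also have "(\<Sum>j\<in>{1..n} - {k}. merge k y lam j * t j) = c"
      unfolding c_def by (intro sum.cong) (auto simp: merge_def)
    finally show ?thesis by (simp add: merge_def)
  qed
  have "((\<lambda>y. (c + y * t k) ^ m / fact m) has_integral
      (c + a * t k) ^ Suc m / (fact (Suc m) * t k) - (c + b * t k) ^ Suc m / (fact (Suc m) * t k)) {b..a}"
  proof (rule fundamental_theorem_of_calculus[OF le])
    fix y
    have "((\<lambda>y. (c + y * t k) ^ Suc m / (fact (Suc m) * t k)) has_real_derivative
        (real (Suc m) * ((c + y * t k) ^ m * t k)) / (fact (Suc m) * t k)) (at y within {b..a})"
      by (intro DERIV_cdivide DERIV_power_Suc[THEN DERIV_cong]) (auto intro!: derivative_eq_intros)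
    also have "(real (Suc m) * ((c + y * t k) ^ m * t k)) / (fact (Suc m) * t k) = (c + y * t k) ^ m / fact m"
      using t by (simp only: fact_Suc of_nat_mult of_nat_fact times_divide_times_eq) simp
    finally have "((\<lambda>y. (c + y * t k) ^ Suc m / (fact (Suc m) * t k)) has_real_derivative
        (c + y * t k) ^ m / fact m) (at y within {b..a})" .
    then show "((\<lambda>y. (c + y * t k) ^ Suc m / (fact (Suc m) * t k)) has_vector_derivative
        (c + y * t k) ^ m / fact m) (at y within {b..a})"
      by (rule has_real_derivative_iff_has_vector_derivative[THEN iffD1])
  qed
  then show ?thesis unfolding L by (simp only: diff_divide_distrib)
qed

lemma volume_at_Suc_integral:
  assumes n: "1 \<le> n" and X: "X 1 = 0" "inj_on X {1..Suc n}" and lam: "dominant (Suc n) lam"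
  obtains S where "volume_at q (Suc n) lam X = (\<Sum>k=1..n. q ^ (k - 1) * S k)"
    "\<And>k. k \<in> {1..n} \<Longrightarrow> ((\<lambda>y. volume_at q n (merge k y lam) (\<lambda>j. X (Suc j))) has_integral S k) {lam (Suc k)..lam k}"
proof (rule that[OF volume_at_Suc[OF n X]])
  fix k assume k: "k \<in> {1..n}"
  let ?Y = "\<lambda>j. X (Suc j)"
  obtain m where m: "n = Suc m" using n by (cases n) auto
  have Y0: "?Y j \<noteq> 0" if "j \<in> {1..n}" for j
    using X that inj_onD[OF X(2), of "Suc j" 1] by auto
  have le: "lam (Suc k) \<le> lam k" using lam k by (auto simp: dominant_def)
  show "((\<lambda>y. volume_at q n (merge k y lam) ?Y) has_integral
      (\<Sum>\<tau> | \<tau> permutes {1..n}. q_kernel q n (?Y \<circ> \<tau>) *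
       ((linear_form n (merge k (lam k) lam) (?Y \<circ> \<tau>) ^ n - linear_form n (merge k (lam (Suc k)) lam) (?Y \<circ> \<tau>) ^ n) /
         (fact n * ?Y (\<tau> k))))) {lam (Suc k)..lam k}"
    unfolding volume_at_def times_divide_eq_right[symmetric]
  proof (intro has_integral_sum has_integral_mult_right)
    show "finite {\<tau>. \<tau> permutes {1..n}}" by (simp add: finite_permutations)
    fix \<tau> assume "\<tau> \<in> {\<tau>. \<tau> permutes {1..n}}"
    then have "(?Y \<circ> \<tau>) k \<noteq> 0" using Y0 k permutes_in_image[of \<tau> "{1..n}" k] by auto
    from has_integral_linear_form_power[where t = "?Y \<circ> \<tau>", OF k this le, of lam m]
    show "((\<lambda>y. linear_form n (merge k y lam) (?Y \<circ> \<tau>) ^ (n - 1) / fact (n - 1)) has_integral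
      (linear_form n (merge k (lam k) lam) (?Y \<circ> \<tau>) ^ n - linear_form n (merge k (lam (Suc k)) lam) (?Y \<circ> \<tau>) ^ n) /
         (fact n * ?Y (\<tau> k))) {lam (Suc k)..lam k}"
      by (simp only: m diff_Suc_1 comp_apply)
  qed
qed

text \<open>
  The induction evaluates at points with a zero coordinate only; the hypothesis \<open>const\<close>, proved
  below by algebra, transports the result to all other points.
\<close>

lemma volume_at_eq_weighted_volume:
  assumes const: "\<And>n lam X X'. inj_on X {1..n} \<Longrightarrow> inj_on X' {1..n} \<Longrightarrow> volume_at q n lam X = volume_at q n lam X'"
    and lam: "dominant (Suc r) lam" and X: "inj_on X {1..Suc r}"
  shows "volume_at q (Suc r) lam X =
    (\<Sum>u | u permutes {1..r}. q ^ perm_length u * proj_vol r (C_polytope r lam u))"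
  using lam X
proof (induction r arbitrary: lam X)
  case 0
  have s: "volume_at q (Suc 0) lam X = 1"
    by (simp add: volume_at_def q_kernel_def q_kernel_factor_def)
  have "{(i, j). i < j \<and> id j < (id i :: nat)} = {}" by auto
  then have "perm_length id = 0" by (simp only: perm_length_def card.empty)
  moreover have "{u. u permutes {1..0::nat}} = {id}" by auto
  moreover have "(\<Sum>u\<in>{a}. f u) = f a" for a :: "nat \<Rightarrow> nat" and f :: "(nat \<Rightarrow> nat) \<Rightarrow> real" by simp
  ultimately have "(\<Sum>u | u permutes {1..0::nat}. q ^ perm_length u * proj_vol 0 (C_polytope 0 lam u)) = 1"
    by (simp only: proj_vol_C_polytope_0 power_0 mult_1)
  from s this[symmetric] show ?case by (rule trans)
next
  case (Suc r)
  \<comment> \<open>the coordinates \<open>0, 1, 2, \<dots>\<close>: the first one is zero, the others are distinct and nonzero\<close>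
  define X0 :: "nat \<Rightarrow> real" where "X0 j = real j - 1" for j
  have X0: "X0 1 = 0" "inj_on X0 {1..Suc (Suc r)}" by (auto simp: X0_def inj_on_def)
  obtain S where S: "volume_at q (Suc (Suc r)) lam X0 = (\<Sum>k=1..Suc r. q ^ (k - 1) * S k)"
    "\<And>k. k \<in> {1..Suc r} \<Longrightarrow> ((\<lambda>y. volume_at q (Suc r) (merge k y lam) (\<lambda>j. X0 (Suc j))) has_integral S k)
       {lam (Suc k)..lam k}"
  proof (rule volume_at_Suc_integral[OF _ X0 Suc.prems(1), of q])
    show "1 \<le> Suc r" by simp
  qed (rule that)
  have "S k = (\<Sum>w | w permutes {1..r}. q ^ perm_length w * proj_vol (Suc r) (C_polytope (Suc r) lam (ins_first k w)))"
    if k: "k \<in> {1..Suc r}" for k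
  proof (rule has_integral_unique[OF S(2)[OF k]])
    have "((\<lambda>y. \<Sum>w | w permutes {1..r}. q ^ perm_length w * proj_vol r (C_polytope r (merge k y lam) w)) has_integral
      (\<Sum>w | w permutes {1..r}. q ^ perm_length w * proj_vol (Suc r) (C_polytope (Suc r) lam (ins_first k w))))
      {lam (Suc k)..lam k}"
      using Suc.prems(1) k
      by (intro has_integral_sum has_integral_mult_right proj_vol_C_polytope_ins_first) (auto simp: finite_permutations)
    moreover have "(\<Sum>w | w permutes {1..r}. q ^ perm_length w * proj_vol r (C_polytope r (merge k y lam) w)) =
        volume_at q (Suc r) (merge k y lam) (\<lambda>j. X0 (Suc j))" if "y \<in> {lam (Suc k)..lam k}" for y
      using k that Suc.prems(1)
      by (intro Suc.IH[symmetric] dominant_merge) (auto simp: X0_def inj_on_def)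
    ultimately show "((\<lambda>y. volume_at q (Suc r) (merge k y lam) (\<lambda>j. X0 (Suc j))) has_integral
      (\<Sum>w | w permutes {1..r}. q ^ perm_length w * proj_vol (Suc r) (C_polytope (Suc r) lam (ins_first k w))))
      {lam (Suc k)..lam k}"
      by (rule has_integral_eq[rotated])
  qed
  then have "volume_at q (Suc (Suc r)) lam X0 = (\<Sum>k=1..Suc r. \<Sum>w | w permutes {1..r}.
      q ^ (k - 1) * (q ^ perm_length w * proj_vol (Suc r) (C_polytope (Suc r) lam (ins_first k w))))"
    unfolding S(1) by (intro sum.cong refl) (simp only: sum_distrib_left)
  also have "\<dots> = (\<Sum>k=1..Suc r. \<Sum>w | w permutes {1..r}.
      q ^ perm_length (ins_first k w) * proj_vol (Suc r) (C_polytope (Suc r) lam (ins_first k w)))"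
  proof (rule sum.cong[OF refl], rule sum.cong[OF refl])
    fix k w assume "k \<in> {1..Suc r}" "w \<in> {w. w permutes {1..r}}"
    then have "perm_length (ins_first k w) = (k - 1) + perm_length w"
      by (intro perm_length_ins_first) auto
    then show "q ^ (k - 1) * (q ^ perm_length w * proj_vol (Suc r) (C_polytope (Suc r) lam (ins_first k w))) =
        q ^ perm_length (ins_first k w) * proj_vol (Suc r) (C_polytope (Suc r) lam (ins_first k w))"
      by (simp only: power_add mult.assoc)
  qed
  also have "\<dots> = (\<Sum>u | u permutes {1..Suc r}. q ^ perm_length u * proj_vol (Suc r) (C_polytope (Suc r) lam u))"
    by (rule sum_permutes_ins_first[symmetric])
  finally show ?case using const[OF Suc.prems(2) X0(2)] by simp
qed

section \<open>Substitution into polynomials\<close>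

text \<open>
  This covers both the permutation of variables (coefficients go to constants, \<open>x\<^sub>i\<close> to
  \<open>x\<^bsub>\<sigma>(i)\<^esub>\<close>) and the evaluation at a real \<open>q\<close> and a real point.
\<close>

definition subst_poly :: "(real poly \<Rightarrow> 'b) \<Rightarrow> (nat \<Rightarrow> 'b) \<Rightarrow> qpoly \<Rightarrow> 'b::comm_ring_1" where
  "subst_poly c g f = (\<Sum>m\<in>Poly_Mapping.keys f. c (Poly_Mapping.lookup f m) *
     (\<Prod>i\<in>Poly_Mapping.keys m. g i ^ Poly_Mapping.lookup m i))"

locale coefficient_hom =
  fixes c :: "real poly \<Rightarrow> 'b::comm_ring_1"
  assumes c_0: "c 0 = 0" and c_1: "c 1 = 1"
    and c_add: "c (a + b) = c a + c b" and c_mult: "c (a * b) = c a * c b"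
begin

definition monomial_value :: "(nat \<Rightarrow> 'b) \<Rightarrow> (nat \<Rightarrow>\<^sub>0 nat) \<Rightarrow> 'b" where
  "monomial_value g m = (\<Prod>i\<in>Poly_Mapping.keys m. g i ^ Poly_Mapping.lookup m i)"

lemma monomial_value_superset:
  assumes "finite K" "Poly_Mapping.keys m \<subseteq> K"
  shows "monomial_value g m = (\<Prod>i\<in>K. g i ^ Poly_Mapping.lookup m i)"
  unfolding monomial_value_def using assms by (intro prod.mono_neutral_left) (auto simp: in_keys_iff)

lemma monomial_value_add: "monomial_value g (m + m') = monomial_value g m * monomial_value g m'"
proof -
  let ?K = "Poly_Mapping.keys m \<union> Poly_Mapping.keys m'"
  have "monomial_value g (m + m') = (\<Prod>i\<in>?K. g i ^ Poly_Mapping.lookup (m + m') i)"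
    by (rule monomial_value_superset) (auto simp: keys_add)
  also have "\<dots> = (\<Prod>i\<in>?K. g i ^ Poly_Mapping.lookup m i) * (\<Prod>i\<in>?K. g i ^ Poly_Mapping.lookup m' i)"
    by (simp add: lookup_add power_add prod.distrib)
  also have "(\<Prod>i\<in>?K. g i ^ Poly_Mapping.lookup m i) = monomial_value g m"
    by (rule monomial_value_superset[symmetric]) auto
  also have "(\<Prod>i\<in>?K. g i ^ Poly_Mapping.lookup m' i) = monomial_value g m'"
    by (rule monomial_value_superset[symmetric]) auto
  finally show ?thesis .
qed

lemma subst_superset:
  assumes "finite K" "Poly_Mapping.keys f \<subseteq> K"
  shows "subst_poly c g f = (\<Sum>m\<in>K. c (Poly_Mapping.lookup f m) * monomial_value g m)"
  unfolding subst_poly_def monomial_value_def[symmetric] using assms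
  by (intro sum.mono_neutral_left) (auto simp: in_keys_iff c_0)

lemma subst_add: "subst_poly c g (f + h) = subst_poly c g f + subst_poly c g h"
proof -
  let ?K = "Poly_Mapping.keys f \<union> Poly_Mapping.keys h"
  have "subst_poly c g (f + h) = (\<Sum>m\<in>?K. c (Poly_Mapping.lookup (f + h) m) * monomial_value g m)"
    using keys_add[of f h] by (intro subst_superset) auto
  also have "\<dots> = (\<Sum>m\<in>?K. c (Poly_Mapping.lookup f m) * monomial_value g m) + (\<Sum>m\<in>?K. c (Poly_Mapping.lookup h m) * monomial_value g m)"
    by (simp add: lookup_add c_add distrib_right sum.distrib)
  also have "\<dots> = subst_poly c g f + subst_poly c g h"
    by (subst (1 2) subst_superset[where K = ?K]) auto
  finally show ?thesis .
qed

lemma subst_0: "subst_poly c g 0 = 0"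
  by (simp add: subst_poly_def)

lemma subst_sum: "subst_poly c g (\<Sum>x\<in>A. f x) = (\<Sum>x\<in>A. subst_poly c g (f x))"
  by (induction A rule: infinite_finite_induct) (simp_all add: subst_0 subst_add)

lemma subst_single: "subst_poly c g (Poly_Mapping.single m a) = c a * monomial_value g m"
  by (subst subst_superset[of "{m}"]) (auto simp: lookup_single)

lemma qpoly_expand: "f = (\<Sum>m\<in>Poly_Mapping.keys f. Poly_Mapping.single m (Poly_Mapping.lookup f m))"
  for f :: qpoly
proof (rule poly_mapping_eqI)
  fix k
  have "(\<Sum>m\<in>Poly_Mapping.keys f. Poly_Mapping.lookup f m when m = k) =
      (\<Sum>m\<in>Poly_Mapping.keys f. if m = k then Poly_Mapping.lookup f k else 0)"
    by (intro sum.cong) (auto simp: when_def)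
  also have "\<dots> = Poly_Mapping.lookup f k" by (simp add: in_keys_iff)
  finally show "Poly_Mapping.lookup f k =
    Poly_Mapping.lookup (\<Sum>m\<in>Poly_Mapping.keys f. Poly_Mapping.single m (Poly_Mapping.lookup f m)) k"
    by (simp add: lookup_sum lookup_single)
qed

lemma subst_mult: "subst_poly c g (f * h) = subst_poly c g f * subst_poly c g h"
proof -
  have "f * h = (\<Sum>m\<in>Poly_Mapping.keys f. \<Sum>m'\<in>Poly_Mapping.keys h.
      Poly_Mapping.single (m + m') (Poly_Mapping.lookup f m * Poly_Mapping.lookup h m'))"
    by (subst qpoly_expand[of f], subst qpoly_expand[of h]) (simp add: sum_product mult_single)
  then have "subst_poly c g (f * h) = (\<Sum>m\<in>Poly_Mapping.keys f. \<Sum>m'\<in>Poly_Mapping.keys h.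
      (c (Poly_Mapping.lookup f m) * monomial_value g m) * (c (Poly_Mapping.lookup h m') * monomial_value g m'))"
    by (simp add: subst_sum subst_single c_mult monomial_value_add mult_ac)
  also have "\<dots> = subst_poly c g f * subst_poly c g h"
    unfolding subst_poly_def monomial_value_def[symmetric] by (simp add: sum_product)
  finally show ?thesis .
qed

lemma subst_const: "subst_poly c g (coeff_const a) = c a"
  by (simp add: coeff_const_def subst_single monomial_value_def)

lemma subst_var: "subst_poly c g (var_x i) = g i"
  by (simp add: var_x_def subst_single monomial_value_def c_1)

lemma subst_1: "subst_poly c g 1 = 1"
  using subst_const[of g 1] by (simp add: coeff_const_def c_1)

lemma subst_minus: "subst_poly c g (- f) = - subst_poly c g f"
proof -
  have "subst_poly c g f + subst_poly c g (- f) = 0"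
    using subst_add[of g f "- f"] by (simp add: subst_0)
  then show ?thesis by (rule minus_unique[symmetric])
qed

lemma subst_diff: "subst_poly c g (f - h) = subst_poly c g f - subst_poly c g h"
  using subst_add[of g f "- h"] by (simp add: subst_minus)

lemma subst_prod: "subst_poly c g (\<Prod>x\<in>A. f x) = (\<Prod>x\<in>A. subst_poly c g (f x))"
  by (induction A rule: infinite_finite_induct) (simp_all add: subst_1 subst_mult)

lemma subst_power: "subst_poly c g (f ^ k) = subst_poly c g f ^ k"
  by (induction k) (simp_all add: subst_1 subst_mult)

lemma subst_sign: "subst_poly c g (of_int (sign \<sigma>) * f) = of_int (sign \<sigma>) * subst_poly c g f"
  by (cases \<sigma> rule: sign_cases) (simp_all add: subst_minus)

lemma subst_permute_vars: "subst_poly c g (permute_vars \<sigma> f) = subst_poly c (g \<circ> \<sigma>) f"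
  unfolding permute_vars_def subst_sum subst_mult subst_prod subst_power subst_const subst_var
  by (simp add: subst_poly_def)

end

lemma coefficient_hom_const: "coefficient_hom coeff_const"
  by standard (simp_all add: coeff_const_def single_add mult_single)

lemma coefficient_hom_poly: "coefficient_hom (\<lambda>p. poly p q)"
  by standard simp_all

interpretation const: coefficient_hom coeff_const by (rule coefficient_hom_const)

interpretation ev: coefficient_hom "\<lambda>p. poly p q" for q by (rule coefficient_hom_poly)

lemma permute_vars_subst: "permute_vars \<sigma> = subst_poly coeff_const (var_x \<circ> \<sigma>)"
  by (rule ext) (simp add: permute_vars_def subst_poly_def)

lemma permute_vars_comp: "permute_vars \<tau> (permute_vars \<sigma> f) = permute_vars (\<tau> \<circ> \<sigma>) f"
  unfolding permute_vars_subst[of \<tau>] const.subst_permute_vars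
  unfolding permute_vars_subst o_assoc ..

section \<open>The Vandermonde product\<close>

definition vandermonde :: "nat \<Rightarrow> (nat \<Rightarrow> 'b) \<Rightarrow> 'b::comm_ring_1" where
  "vandermonde n f = (\<Prod>i\<in>{1..n}. \<Prod>j\<in>{1..n}. if i < j then f i - f j else 1)"

text \<open>
  The factors of a third index \<open>c\<close> with \<open>a\<close> and with \<open>b\<close> are exchanged; if \<open>c\<close> lies between
  \<open>a\<close> and \<open>b\<close>, both change sign. So only the sign of the factor of the pair \<open>a\<close>, \<open>b\<close> survives.
\<close>

lemma vandermonde_transpose:
  fixes f :: "nat \<Rightarrow> 'b::comm_ring_1"
  assumes "a \<in> {1..n}" "b \<in> {1..n}" "a < b"
  shows "vandermonde n (f \<circ> Transposition.transpose a b) = - vandermonde n f"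
proof -
  let ?t = "Transposition.transpose a b"
  have ne: "a \<noteq> b" using assms by simp
  note split = prod.double_split_two[OF finite_atLeastAtMost assms(1,2) ne]
  have 1: "(\<Prod>i\<in>{1..n}-{a,b}. \<Prod>j\<in>{1..n}-{a,b}. if i < j then (f \<circ> ?t) i - (f \<circ> ?t) j else 1) =
      (\<Prod>i\<in>{1..n}-{a,b}. \<Prod>j\<in>{1..n}-{a,b}. if i < j then f i - f j else 1)"
    by (intro prod.cong refl) (auto simp: Transposition.transpose_def)
  have 2: "(\<Prod>c\<in>{1..n}-{a,b}. (if a < c then (f \<circ> ?t) a - (f \<circ> ?t) c else 1) *
        (if c < a then (f \<circ> ?t) c - (f \<circ> ?t) a else 1) *
        (if b < c then (f \<circ> ?t) b - (f \<circ> ?t) c else 1) *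
        (if c < b then (f \<circ> ?t) c - (f \<circ> ?t) b else 1)) =
      (\<Prod>c\<in>{1..n}-{a,b}. (if a < c then f a - f c else 1) * (if c < a then f c - f a else 1) *
        (if b < c then f b - f c else 1) * (if c < b then f c - f b else 1))"
  proof (rule prod.cong[OF refl])
    fix c assume c: "c \<in> {1..n} - {a,b}"
    then have t: "(f \<circ> ?t) c = f c" "(f \<circ> ?t) a = f b" "(f \<circ> ?t) b = f a"
      by (auto simp: Transposition.transpose_def)
    consider "c < a" | "a < c" "c < b" | "b < c" using c by fastforce
    then show "(if a < c then (f \<circ> ?t) a - (f \<circ> ?t) c else 1) *
        (if c < a then (f \<circ> ?t) c - (f \<circ> ?t) a else 1) *
        (if b < c then (f \<circ> ?t) b - (f \<circ> ?t) c else 1) *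
        (if c < b then (f \<circ> ?t) c - (f \<circ> ?t) b else 1) =
        (if a < c then f a - f c else 1) * (if c < a then f c - f a else 1) *
        (if b < c then f b - f c else 1) * (if c < b then f c - f b else 1)"
      unfolding t using assms(3) by cases (simp_all add: algebra_simps)
  qed
  show ?thesis
    unfolding vandermonde_def split 1 2 using assms(3) by (simp add: algebra_simps)
qed

lemma vandermonde_permute:
  fixes f :: "nat \<Rightarrow> 'b::comm_ring_1"
  assumes "\<sigma> permutes {1..n}"
  shows "vandermonde n (f \<circ> \<sigma>) = of_int (sign \<sigma>) * vandermonde n f"
  using finite_atLeastAtMost assms
proof (induction \<sigma> rule: permutes_rev_induct)
  case (swap a b p)
  let ?t = "Transposition.transpose a b"
  have t: "vandermonde n ((f \<circ> p) \<circ> ?t) = - vandermonde n (f \<circ> p)"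
  proof (cases "a < b")
    case False
    have "vandermonde n ((f \<circ> p) \<circ> Transposition.transpose b a) = - vandermonde n (f \<circ> p)"
      by (rule vandermonde_transpose) (use swap False in auto)
    then show ?thesis unfolding transpose_commute[of b a] .
  qed (rule vandermonde_transpose, use swap in auto)
  have "permutation p" "permutation ?t"
    using swap permutation_permutes by (auto simp: permutation_swap_id)
  then have sg: "sign (p \<circ> ?t) = - sign p"
    using swap by (simp add: sign_compose sign_swap_id)
  show ?case unfolding o_assoc t swap.IH sg by simp
qed simp

lemma vandermonde_nonzero:
  fixes f :: "nat \<Rightarrow> 'b::idom"
  assumes "inj_on f {1..n}"
  shows "vandermonde n f \<noteq> 0"
proof -
  have "(if i < j then f i - f j else 1) \<noteq> 0" if "i \<in> {1..n}" "j \<in> {1..n}" for i j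
  proof (cases "i < j")
    case True
    with inj_onD[OF assms _ that] show ?thesis by fastforce
  qed simp
  then show ?thesis unfolding vandermonde_def by (simp only: prod_zero_iff finite_atLeastAtMost) blast
qed

section \<open>Alternating polynomials of minimal degree\<close>

definition homogeneous :: "nat \<Rightarrow> nat \<Rightarrow> qpoly \<Rightarrow> bool" where
  "homogeneous n d f \<longleftrightarrow> (\<forall>m\<in>Poly_Mapping.keys f. Poly_Mapping.keys m \<subseteq> {1..n} \<and>
     (\<Sum>i\<in>{1..n}. Poly_Mapping.lookup m i) = d)"

lemma homogeneous_0: "homogeneous n d 0"
  by (simp add: homogeneous_def)

lemma homogeneous_add:
  assumes "homogeneous n d f" "homogeneous n d g"
  shows "homogeneous n d (f + g)"
  unfolding homogeneous_def
proof
  fix m assume "m \<in> Poly_Mapping.keys (f + g)"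
  then have "m \<in> Poly_Mapping.keys f \<or> m \<in> Poly_Mapping.keys g"
    using keys_add[of f g] by blast
  then show "Poly_Mapping.keys m \<subseteq> {1..n} \<and> (\<Sum>i\<in>{1..n}. Poly_Mapping.lookup m i) = d"
    using assms unfolding homogeneous_def by blast
qed

lemma homogeneous_minus:
  assumes "homogeneous n d f"
  shows "homogeneous n d (- f)"
  unfolding homogeneous_def
proof
  fix m assume "m \<in> Poly_Mapping.keys (- f)"
  then have "m \<in> Poly_Mapping.keys f" by (simp only: in_keys_iff lookup_uminus neg_equal_0_iff_equal not_False_eq_True)
  then show "Poly_Mapping.keys m \<subseteq> {1..n} \<and> (\<Sum>i\<in>{1..n}. Poly_Mapping.lookup m i) = d"
    using assms unfolding homogeneous_def by blast
qed

lemma homogeneous_sum: "(\<And>x. x \<in> A \<Longrightarrow> homogeneous n d (f x)) \<Longrightarrow> homogeneous n d (\<Sum>x\<in>A. f x)"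
  by (induction A rule: infinite_finite_induct) (simp_all add: homogeneous_0 homogeneous_add)

lemma homogeneous_mult:
  assumes "homogeneous n d f" "homogeneous n e g"
  shows "homogeneous n (d + e) (f * g)"
  unfolding homogeneous_def
proof
  fix m assume "m \<in> Poly_Mapping.keys (f * g)"
  then obtain a b where ab: "m = a + b" "a \<in> Poly_Mapping.keys f" "b \<in> Poly_Mapping.keys g"
    using keys_mult[of f g] by blast
  then show "Poly_Mapping.keys m \<subseteq> {1..n} \<and> (\<Sum>i\<in>{1..n}. Poly_Mapping.lookup m i) = d + e"
    using assms keys_add[of a b] by (fastforce simp: homogeneous_def lookup_add sum.distrib)
qed

lemma homogeneous_const: "homogeneous n 0 (coeff_const a)"
  by (simp add: homogeneous_def coeff_const_def)

lemma homogeneous_1: "homogeneous n 0 1"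
  using homogeneous_const[of n 1] by (simp add: coeff_const_def)

lemma homogeneous_var:
  assumes "i \<in> {1..n}"
  shows "homogeneous n 1 (var_x i)"
proof -
  have "(\<Sum>j\<in>{1..n}. Poly_Mapping.lookup (Poly_Mapping.single i 1) j) = (\<Sum>j\<in>{1..n}. if i = j then 1 else 0 :: nat)"
    by (intro sum.cong refl) (simp add: lookup_single when_def)
  also have "\<dots> = 1" using assms by (simp only: sum.delta' finite_atLeastAtMost if_True)
  finally show ?thesis using assms by (simp add: homogeneous_def var_x_def)
qed

lemma homogeneous_power:
  assumes "homogeneous n d f"
  shows "homogeneous n (k * d) (f ^ k)"
proof (induction k)
  case (Suc k)
  from homogeneous_mult[OF assms Suc] show ?case by simp
qed (simp add: homogeneous_1)

lemma homogeneous_prod: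
  "(\<And>x. x \<in> A \<Longrightarrow> homogeneous n 1 (f x)) \<Longrightarrow> homogeneous n (card A) (\<Prod>x\<in>A. f x)"
proof (induction A rule: infinite_finite_induct)
  case (insert x A)
  then have "homogeneous n (1 + card A) (f x * prod f A)" by (intro homogeneous_mult) auto
  then show ?case using insert by simp
qed (simp_all add: homogeneous_1)

lemma homogeneous_permute_vars:
  assumes "homogeneous n d f" "\<sigma> permutes {1..n}"
  shows "homogeneous n d (permute_vars \<sigma> f)"
  unfolding permute_vars_def
proof (rule homogeneous_sum)
  fix m assume m: "m \<in> Poly_Mapping.keys f"
  then have k: "Poly_Mapping.keys m \<subseteq> {1..n}" and d: "(\<Sum>i\<in>{1..n}. Poly_Mapping.lookup m i) = d"
    using assms(1) by (auto simp: homogeneous_def)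
  have *: "homogeneous n (\<Sum>i\<in>K. e i) (\<Prod>i\<in>K. var_x (\<sigma> i) ^ e i)" if "K \<subseteq> {1..n}" "finite K" for K e
    using that(2,1)
  proof (induction K rule: finite_induct)
    case (insert i K)
    have "\<sigma> i \<in> {1..n}" using insert permutes_in_image[OF assms(2)] by blast
    from homogeneous_power[OF homogeneous_var[OF this], of "e i"]
    have "homogeneous n (e i) (var_x (\<sigma> i) ^ e i)" by simp
    from homogeneous_mult[OF this] insert show ?case by simp
  qed (simp add: homogeneous_1)
  have "(\<Sum>i\<in>Poly_Mapping.keys m. Poly_Mapping.lookup m i) = d"
    unfolding d[symmetric] using k by (intro sum.mono_neutral_left) (auto simp: in_keys_iff)
  with *[OF k finite_keys, of "Poly_Mapping.lookup m"]
  have "homogeneous n d (\<Prod>i\<in>Poly_Mapping.keys m. var_x (\<sigma> i) ^ Poly_Mapping.lookup m i)" by simp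
  from homogeneous_mult[OF homogeneous_const this]
  show "homogeneous n d (coeff_const (Poly_Mapping.lookup f m) *
      (\<Prod>i\<in>Poly_Mapping.keys m. var_x (\<sigma> i) ^ Poly_Mapping.lookup m i))" by simp
qed

text \<open>
  The monomial obtained by substituting \<open>x\<^bsub>\<sigma>(i)\<^esub>\<close> for \<open>x\<^sub>i\<close>: the exponent of \<open>x\<^sub>i\<close> becomes that
  of \<open>x\<^bsub>\<sigma>(i)\<^esub>\<close>.
\<close>

definition permute_monomial :: "(nat \<Rightarrow> nat) \<Rightarrow> (nat \<Rightarrow>\<^sub>0 nat) \<Rightarrow> (nat \<Rightarrow>\<^sub>0 nat)" where
  "permute_monomial \<sigma> m = Poly_Mapping.map_key (inv \<sigma>) m"

lemma lookup_permute_monomial: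
  assumes "bij \<sigma>"
  shows "Poly_Mapping.lookup (permute_monomial \<sigma> m) i = Poly_Mapping.lookup m (inv \<sigma> i)"
  using bij_is_inj[OF bij_imp_bij_inv[OF assms]] by (simp add: permute_monomial_def map_key.rep_eq)

lemma permute_monomial_inject:
  assumes "bij \<sigma>"
  shows "permute_monomial \<sigma> m = permute_monomial \<sigma> m' \<longleftrightarrow> m = m'"
proof
  assume eq: "permute_monomial \<sigma> m = permute_monomial \<sigma> m'"
  show "m = m'"
  proof (rule poly_mapping_eqI)
    fix i
    have "Poly_Mapping.lookup (permute_monomial \<sigma> m) (\<sigma> i) = Poly_Mapping.lookup (permute_monomial \<sigma> m') (\<sigma> i)"
      using eq by simp
    then show "Poly_Mapping.lookup m i = Poly_Mapping.lookup m' i"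
      unfolding lookup_permute_monomial[OF assms] by (simp add: inv_f_f bij_is_inj[OF assms])
  qed
qed simp

lemma permuted_monomial:
  assumes "bij \<sigma>"
  shows "(\<Prod>i\<in>Poly_Mapping.keys m. var_x (\<sigma> i) ^ Poly_Mapping.lookup m i) = Poly_Mapping.single (permute_monomial \<sigma> m) 1"
proof -
  have p: "var_x i ^ k = Poly_Mapping.single (Poly_Mapping.single i k) 1" for i k
  proof (induction k)
    case (Suc k)
    then show ?case by (simp add: var_x_def mult_single single_add[symmetric])
  qed simp
  have s: "(\<Prod>i\<in>K. Poly_Mapping.single (e i) (1 :: real poly)) = Poly_Mapping.single (\<Sum>i\<in>K. e i) 1"
    for K :: "nat set" and e :: "nat \<Rightarrow> nat \<Rightarrow>\<^sub>0 nat"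
    by (induction K rule: infinite_finite_induct) (simp_all add: mult_single)
  have "(\<Sum>i\<in>Poly_Mapping.keys m. Poly_Mapping.single (\<sigma> i) (Poly_Mapping.lookup m i)) = permute_monomial \<sigma> m"
  proof (rule poly_mapping_eqI)
    fix x
    have "(\<Sum>i\<in>Poly_Mapping.keys m. Poly_Mapping.lookup (Poly_Mapping.single (\<sigma> i) (Poly_Mapping.lookup m i)) x) =
        (\<Sum>i\<in>Poly_Mapping.keys m. if i = inv \<sigma> x then Poly_Mapping.lookup m (inv \<sigma> x) else 0)"
      using bij_inv_eq_iff[OF assms] inv_f_f[OF bij_is_inj[OF assms]]
      by (intro sum.cong) (auto simp: lookup_single when_def)
    also have "\<dots> = Poly_Mapping.lookup m (inv \<sigma> x)" by (simp add: in_keys_iff)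
    finally show "Poly_Mapping.lookup (\<Sum>i\<in>Poly_Mapping.keys m. Poly_Mapping.single (\<sigma> i) (Poly_Mapping.lookup m i)) x =
        Poly_Mapping.lookup (permute_monomial \<sigma> m) x"
      unfolding lookup_sum lookup_permute_monomial[OF assms] .
  qed
  then show ?thesis unfolding p s by simp
qed

lemma lookup_permute_vars:
  assumes "bij \<sigma>"
  shows "Poly_Mapping.lookup (permute_vars \<sigma> f) (permute_monomial \<sigma> m) = Poly_Mapping.lookup f m"
proof -
  have "Poly_Mapping.lookup (permute_vars \<sigma> f) (permute_monomial \<sigma> m) =
      (\<Sum>k\<in>Poly_Mapping.keys f. Poly_Mapping.lookup (Poly_Mapping.single (permute_monomial \<sigma> k) (Poly_Mapping.lookup f k)) (permute_monomial \<sigma> m))"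
    unfolding permute_vars_def permuted_monomial[OF assms] coeff_const_def lookup_sum
    by (simp add: mult_single)
  also have "\<dots> = (\<Sum>k\<in>Poly_Mapping.keys f. if k = m then Poly_Mapping.lookup f m else 0)"
    by (intro sum.cong) (auto simp: lookup_single when_def permute_monomial_inject[OF assms])
  also have "\<dots> = Poly_Mapping.lookup f m" by (simp add: in_keys_iff)
  finally show ?thesis .
qed

definition alternating :: "nat \<Rightarrow> qpoly \<Rightarrow> bool" where
  "alternating n f \<longleftrightarrow> (\<forall>\<sigma>. \<sigma> permutes {1..n} \<longrightarrow> permute_vars \<sigma> f = of_int (sign \<sigma>) * f)"

lemma lookup_sign: "Poly_Mapping.lookup (of_int (sign \<sigma>) * f) m = of_int (sign \<sigma>) * Poly_Mapping.lookup f m"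
  for f :: qpoly
  by (cases \<sigma> rule: sign_cases) simp_all

lemma lookup_alternating:
  assumes "alternating n f" "\<sigma> permutes {1..n}"
  shows "Poly_Mapping.lookup f (permute_monomial \<sigma> m) = of_int (sign \<sigma>) * Poly_Mapping.lookup f m"
proof -
  have "Poly_Mapping.lookup f m = of_int (sign \<sigma>) * Poly_Mapping.lookup f (permute_monomial \<sigma> m)"
    using lookup_permute_vars[OF permutes_bij[OF assms(2)], of f m] assms
    by (simp add: alternating_def lookup_sign)
  then show ?thesis by (cases \<sigma> rule: sign_cases) simp_all
qed

text \<open>
  Trading the elements of \<open>S\<close> that are at least \<open>n\<close> for equally many missing numbers below \<open>n\<close>
  would lower the sum by at least one for each.
\<close>

lemma nats_with_minimal_sum:
  fixes S :: "nat set"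
  assumes "finite S" "card S = n" "\<Sum>S = \<Sum>{0..<n}"
  shows "S = {0..<n}"
proof -
  let ?A = "S - {0..<n}" and ?B = "{0..<n} - S"
  have S: "S = (S \<inter> {0..<n}) \<union> ?A" and N: "{0..<n} = (S \<inter> {0..<n}) \<union> ?B" by auto
  have cS: "card (S \<inter> {0..<n}) + card ?A = n"
    using assms(1,2) S by (metis card_Un_disjoint finite_Diff finite_Int Diff_disjoint Int_Diff inf_commute inf_left_commute inf_bot_right)
  have "card ((S \<inter> {0..<n}) \<union> ?B) = card (S \<inter> {0..<n}) + card ?B"
    by (rule card_Un_disjoint) auto
  then have cN: "card (S \<inter> {0..<n}) + card ?B = n" using N by simp
  have "\<Sum>((S \<inter> {0..<n}) \<union> ?A) = \<Sum>(S \<inter> {0..<n}) + \<Sum>?A"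
    using assms(1) by (intro sum.union_disjoint) auto
  moreover have "\<Sum>((S \<inter> {0..<n}) \<union> ?B) = \<Sum>(S \<inter> {0..<n}) + \<Sum>?B"
    by (intro sum.union_disjoint) auto
  ultimately have eq: "\<Sum>?A = \<Sum>?B" using assms(3) S N by simp
  have A: "card ?A * n \<le> \<Sum>?A"
    using sum_bounded_below[of ?A n "\<lambda>x. x"] by auto
  have B: "\<Sum>?B + card ?B \<le> card ?B * n"
  proof -
    have "\<Sum>?B + card ?B = (\<Sum>x\<in>?B. x + 1)" by (simp only: sum.distrib) simp
    also have "\<dots> \<le> card ?B * n" using sum_bounded_above[of ?B "\<lambda>x. x + 1" n] by auto
    finally show ?thesis .
  qed
  have c: "card ?A = card ?B" using cS cN by linarith
  have "card ?B = 0" using A B unfolding eq c by linarith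
  moreover from this have "card ?A = 0" using c by linarith
  ultimately have "?B = {}" "?A = {}"
    using assms(1) by (simp_all only: card_0_eq finite_Diff finite_atLeastLessThan)
  then show ?thesis by blast
qed

text \<open>
  The exponents \<open>0, 1, \<dots>, n - 1\<close> of \<open>x\<^sub>1, \<dots>, x\<^sub>n\<close>.
\<close>

definition staircase :: "nat \<Rightarrow> (nat \<Rightarrow>\<^sub>0 nat)" where
  "staircase n = (\<Sum>i\<in>{1..n}. Poly_Mapping.single i (i - 1))"

lemma lookup_staircase: "Poly_Mapping.lookup (staircase n) i = (if i \<in> {1..n} then i - 1 else 0)"
proof -
  have "Poly_Mapping.lookup (staircase n) i = (\<Sum>j\<in>{1..n}. if j = i then i - 1 else 0)"
    unfolding staircase_def lookup_sum lookup_single by (intro sum.cong) (auto simp: when_def)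
  then show ?thesis by (simp only: sum.delta finite_atLeastAtMost)
qed

text \<open>
  The integer \<open>s\<close> depends on the monomial alone. It is zero if the degree is wrong or
  two exponents agree, since the exchange of two equal exponents changes the sign of the
  coefficient and fixes the monomial. Otherwise the exponents are \<open>0, \<dots>, n - 1\<close> in some order and
  \<open>s\<close> is the sign of that order.
\<close>

lemma alternating_coefficient:
  fixes m :: "nat \<Rightarrow>\<^sub>0 nat"
  obtains s :: int where "\<And>f. alternating n f \<Longrightarrow> homogeneous n (\<Sum>{0..<n}) f \<Longrightarrow>
    Poly_Mapping.lookup f m = of_int s * Poly_Mapping.lookup f (staircase n)"
proof (cases "Poly_Mapping.keys m \<subseteq> {1..n} \<and> (\<Sum>i\<in>{1..n}. Poly_Mapping.lookup m i) = \<Sum>{0..<n}")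
  case False
  then have "m \<notin> Poly_Mapping.keys f" if "homogeneous n (\<Sum>{0..<n}) f" for f
    using that by (auto simp: homogeneous_def)
  then show ?thesis by (intro that[of 0]) (simp add: in_keys_iff)
next
  case hom: True
  show ?thesis
  proof (cases "inj_on (Poly_Mapping.lookup m) {1..n}")
    case False
    then obtain i j where ij: "i \<in> {1..n}" "j \<in> {1..n}" "i \<noteq> j"
      "Poly_Mapping.lookup m i = Poly_Mapping.lookup m j" by (auto simp: inj_on_def)
    let ?t = "Transposition.transpose i j"
    have t: "?t permutes {1..n}" using ij by (intro permutes_swap_id)
    have "permute_monomial ?t m = m"
      using ij by (intro poly_mapping_eqI) (auto simp: lookup_permute_monomial[OF permutes_bij[OF t]] Transposition.transpose_def)
    then have "Poly_Mapping.lookup f m = - Poly_Mapping.lookup f m" if "alternating n f" for f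
      using lookup_alternating[OF that t, of m] ij(3) by (simp add: sign_swap_id)
    then show ?thesis by (intro that[of 0]) simp
  next
    case True
    then have "Poly_Mapping.lookup m ` {1..n} = {0..<n}"
      using hom by (intro nats_with_minimal_sum) (auto simp: card_image sum.reindex)
    then have img: "(\<lambda>i. Poly_Mapping.lookup m i + 1) ` {1..n} = {1..n}"
    proof -
      have "(\<lambda>i. Poly_Mapping.lookup m i + 1) ` {1..n} = Suc ` {0..<n}"
        unfolding \<open>Poly_Mapping.lookup m ` {1..n} = {0..<n}\<close>[symmetric] image_image by simp
      also have "\<dots> = {1..n}" by (simp add: image_Suc_atLeastLessThan atLeastLessThanSuc_atLeastAtMost)
      finally show ?thesis .
    qed
    \<comment> \<open>the order of the exponents, as a permutation; adding one matches the range \<open>{1..n}\<close>\<close>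
    define p where "p i = (if i \<in> {1..n} then Poly_Mapping.lookup m i + 1 else i)" for i
    have p: "p permutes {1..n}"
    proof (rule bij_imp_permutes)
      have "p ` {1..n} = {1..n}" using img by (simp add: p_def)
      moreover have "inj_on p {1..n}"
      proof (rule inj_onI)
        fix x y assume xy: "x \<in> {1..n}" "y \<in> {1..n}" "p x = p y"
        then have "Poly_Mapping.lookup m x = Poly_Mapping.lookup m y" by (simp add: p_def)
        then show "x = y" by (rule inj_onD[OF True _ xy(1,2)])
      qed
      ultimately show "bij_betw p {1..n} {1..n}" by (simp add: bij_betw_def)
    next
      fix x assume "x \<notin> {1..n}"
      then show "p x = x" unfolding p_def by (rule if_not_P)
    qed
    have "permute_monomial (inv p) (staircase n) = m"
    proof (rule poly_mapping_eqI)
      fix i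
      have "Poly_Mapping.lookup (permute_monomial (inv p) (staircase n)) i = Poly_Mapping.lookup (staircase n) (p i)"
        unfolding lookup_permute_monomial[OF bij_imp_bij_inv[OF permutes_bij[OF p]]] inv_inv_eq[OF permutes_bij[OF p]] ..
      also have "\<dots> = Poly_Mapping.lookup m i"
      proof (cases "i \<in> {1..n}")
        case True
        then have "p i \<in> {1..n}" using permutes_in_image[OF p] by blast
        then show ?thesis using True by (simp add: lookup_staircase p_def)
      next
        case False
        have "i \<notin> Poly_Mapping.keys m" "p i = i" 
          using hom False by (blast, simp only: p_def if_False)
        moreover have "Poly_Mapping.lookup (staircase n) i = 0"
          unfolding lookup_staircase using False by (rule if_not_P)
        ultimately show ?thesis by (simp add: in_keys_iff)
      qed
      finally show "Poly_Mapping.lookup (permute_monomial (inv p) (staircase n)) i = Poly_Mapping.lookup m i" .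
    qed
    with lookup_alternating[OF _ permutes_inv[OF p], where m = "staircase n"] show ?thesis
      by (intro that[of "sign (inv p)"]) (simp only:)
  qed
qed

section \<open>The bracket as a multiple of the Vandermonde product\<close>

lemma prod_pairs:
  fixes f :: "nat \<Rightarrow> nat \<Rightarrow> 'b::comm_monoid_mult"
  assumes "\<And>i j. P i j \<Longrightarrow> i < j"
  shows "(\<Prod>(i, j)\<in>{(i, j). 1 \<le> i \<and> P i j \<and> j \<le> n}. f i j) =
    (\<Prod>i\<in>{1..n}. \<Prod>j\<in>{1..n}. if P i j then f i j else 1)"
proof -
  have "{(i, j). 1 \<le> i \<and> P i j \<and> j \<le> n} = {x \<in> {1..n} \<times> {1..n}. P (fst x) (snd x)}"
    using assms by fastforce
  then have "(\<Prod>(i, j)\<in>{(i, j). 1 \<le> i \<and> P i j \<and> j \<le> n}. f i j) =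
      (\<Prod>x\<in>{x \<in> {1..n} \<times> {1..n}. P (fst x) (snd x)}. f (fst x) (snd x))"
    by (simp only: case_prod_unfold)
  also have "\<dots> = (\<Prod>x\<in>{1..n} \<times> {1..n}. if P (fst x) (snd x) then f (fst x) (snd x) else 1)"
    by (rule prod.inter_filter) simp
  also have "\<dots> = (\<Prod>i\<in>{1..n}. \<Prod>j\<in>{1..n}. if P i j then f i j else 1)"
    by (simp only: prod.cartesian_product case_prod_unfold)
  finally show ?thesis .
qed

lemma vandermonde_pairs: "vandermonde n f = (\<Prod>(i, j)\<in>{(i, j). 1 \<le> i \<and> i < j \<and> j \<le> n}. f i - f j)"
  unfolding vandermonde_def by (rule prod_pairs[symmetric])

lemma finite_pairs: "finite {(i, j). (1 :: nat) \<le> i \<and> i < j \<and> j \<le> n}"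
  by (rule finite_subset[of _ "{1..n} \<times> {1..n}"]) auto

lemma card_pairs: "card {(i, j). (1 :: nat) \<le> i \<and> i < j \<and> j \<le> n} = \<Sum>{0..<n}"
proof (induction n)
  case (Suc n)
  have "{(i, j). (1 :: nat) \<le> i \<and> i < j \<and> j \<le> Suc n} =
      {(i, j). 1 \<le> i \<and> i < j \<and> j \<le> n} \<union> (\<lambda>i. (i, Suc n)) ` {1..n}"
    by (auto simp: le_Suc_eq)
  also have "card \<dots> = card {(i, j). (1 :: nat) \<le> i \<and> i < j \<and> j \<le> n} + card ((\<lambda>i. (i, Suc n)) ` {1..n})"
    by (intro card_Un_disjoint finite_pairs) auto
  also have "card ((\<lambda>i. (i, Suc n)) ` {1..n}) = n"
    by (subst card_image) (auto simp: inj_on_def)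
  finally show ?case using Suc by simp
next
  case 0
  have "{(i, j). (1 :: nat) \<le> i \<and> i < j \<and> j \<le> 0} = {}" by auto
  then show ?case by (simp only: card.empty) simp
qed

text \<open>
  The \<open>n - 1\<close> adjacent pairs that are missing from the product in the bracket are made up for by
  the \<open>(n - 1)\<close>-st power of the linear form, so the total degree is that of the Vandermonde product.
\<close>

lemma card_nonadjacent_pairs:
  "(n - 1) + card {(i, j). (1 :: nat) \<le> i \<and> i + 1 < j \<and> j \<le> n} = \<Sum>{0..<n}"
proof -
  have "{(i, j). (1 :: nat) \<le> i \<and> i < j \<and> j \<le> n} =
      {(i, j). 1 \<le> i \<and> i + 1 < j \<and> j \<le> n} \<union> {(i, j). 1 \<le> i \<and> j = i + 1 \<and> j \<le> n}"
    by auto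
  also have "{(i, j). (1 :: nat) \<le> i \<and> j = i + 1 \<and> j \<le> n} = (\<lambda>i. (i, i + 1)) ` {1..<n}"
    by auto
  also have "card ({(i, j). (1 :: nat) \<le> i \<and> i + 1 < j \<and> j \<le> n} \<union> (\<lambda>i. (i, i + 1)) ` {1..<n}) =
      card {(i, j). (1 :: nat) \<le> i \<and> i + 1 < j \<and> j \<le> n} + card ((\<lambda>i. (i, i + 1)) ` {1..<n})"
  proof (rule card_Un_disjoint)
    show "finite {(i, j). (1 :: nat) \<le> i \<and> i + 1 < j \<and> j \<le> n}"
      by (rule finite_subset[OF _ finite_pairs[of n]]) auto
  qed auto
  also have "card ((\<lambda>i. (i, i + 1)) ` {1..<n}) = n - 1"
    by (subst card_image) (auto simp: inj_on_def)
  finally show ?thesis unfolding card_pairs by simp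
qed

definition antisymmetrize :: "nat \<Rightarrow> qpoly \<Rightarrow> qpoly" where
  "antisymmetrize n f = (\<Sum>\<sigma> | \<sigma> permutes {1..n}. of_int (sign \<sigma>) * permute_vars \<sigma> f)"

lemma alternating_antisymmetrize: "alternating n (antisymmetrize n f)"
  unfolding alternating_def
proof (intro allI impI)
  fix \<tau> :: "nat \<Rightarrow> nat" assume \<tau>: "\<tau> permutes {1..n}"
  have sg: "(of_int (sign (\<tau> \<circ> \<sigma>)) :: qpoly) = of_int (sign \<tau>) * of_int (sign \<sigma>)" if "\<sigma> permutes {1..n}" for \<sigma>
  proof -
    have "permutation \<tau>" "permutation \<sigma>"
      using \<tau> that permutation_permutes finite_atLeastAtMost by blast+
    then show ?thesis by (simp add: sign_compose)
  qed
  have "of_int (sign \<tau>) * antisymmetrize n f =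
      of_int (sign \<tau>) * (\<Sum>\<sigma> | \<sigma> permutes {1..n}. of_int (sign (\<tau> \<circ> \<sigma>)) * permute_vars (\<tau> \<circ> \<sigma>) f)"
    unfolding antisymmetrize_def
    by (rule arg_cong[where f = "\<lambda>x. of_int (sign \<tau>) * x"])
       (rule sum.reindex_bij_witness[of _ "\<lambda>\<sigma>. \<tau> \<circ> \<sigma>" "\<lambda>\<sigma>. inv \<tau> \<circ> \<sigma>"],
        use \<tau> in \<open>auto simp: o_assoc permutes_inv_o[OF \<tau>] intro!: permutes_compose permutes_inv\<close>)
  also have "\<dots> = (\<Sum>\<sigma> | \<sigma> permutes {1..n}. of_int (sign \<sigma>) * permute_vars (\<tau> \<circ> \<sigma>) f)"
    unfolding sum_distrib_left
  proof (rule sum.cong[OF refl])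
    fix \<sigma> assume "\<sigma> \<in> {\<sigma>. \<sigma> permutes {1..n}}"
    then have "\<sigma> permutes {1..n}" by simp
    then show "of_int (sign \<tau>) * (of_int (sign (\<tau> \<circ> \<sigma>)) * permute_vars (\<tau> \<circ> \<sigma>) f) =
        of_int (sign \<sigma>) * permute_vars (\<tau> \<circ> \<sigma>) f"
      unfolding sg[OF \<open>\<sigma> permutes {1..n}\<close>] by (cases \<tau> rule: sign_cases) simp_all
  qed
  also have "\<dots> = permute_vars \<tau> (antisymmetrize n f)"
    unfolding antisymmetrize_def permute_vars_comp[symmetric] permute_vars_subst[of \<tau>]
    unfolding const.subst_sum const.subst_sign ..
  finally show "permute_vars \<tau> (antisymmetrize n f) = of_int (sign \<tau>) * antisymmetrize n f" ..
qed

lemma homogeneous_sign: "homogeneous n d f \<Longrightarrow> homogeneous n d (of_int (sign \<sigma>) * f)"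
  by (cases \<sigma> rule: sign_cases) (simp_all add: homogeneous_minus)

lemma homogeneous_antisymmetrize: "homogeneous n d f \<Longrightarrow> homogeneous n d (antisymmetrize n f)"
  unfolding antisymmetrize_def
  by (rule homogeneous_sum) (simp add: homogeneous_sign homogeneous_permute_vars)

lemma (in coefficient_hom) subst_vandermonde: "subst_poly c g (vandermonde n var_x) = vandermonde n g"
  unfolding vandermonde_pairs subst_prod
  by (rule prod.cong[OF refl]) (auto simp: subst_diff subst_var)

lemma alternating_vandermonde: "alternating n (vandermonde n var_x)"
  unfolding alternating_def permute_vars_subst const.subst_vandermonde by (simp add: vandermonde_permute)

lemma homogeneous_diff: "homogeneous n d f \<Longrightarrow> homogeneous n d g \<Longrightarrow> homogeneous n d (f - g)"
  using homogeneous_add[OF _ homogeneous_minus, of n d f g] by simp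

lemma homogeneous_vandermonde: "homogeneous n (\<Sum>{0..<n}) (vandermonde n var_x)"
  unfolding vandermonde_pairs card_pairs[symmetric]
  by (rule homogeneous_prod) (auto intro!: homogeneous_diff homogeneous_var[simplified])

definition bracket_argument :: "nat \<Rightarrow> (nat \<Rightarrow> real) \<Rightarrow> qpoly" where
  "bracket_argument n lam = (\<Sum>i=1..n. coeff_const [:lam i:] * var_x i) ^ (n - 1) *
     (\<Prod>(i, j)\<in>{(i, j). 1 \<le> i \<and> i + 1 < j \<and> j \<le> n}. coeff_const var_q * var_x i - var_x j)"

lemma homogeneous_bracket_argument: "homogeneous n (\<Sum>{0..<n}) (bracket_argument n lam)"
proof -
  have cm: "homogeneous n 1 (coeff_const a * var_x i)" if "i \<in> {1..n}" for a i
    using homogeneous_mult[OF homogeneous_const homogeneous_var[OF that]] by simp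
  have "homogeneous n 1 (\<Sum>i=1..n. coeff_const [:lam i:] * var_x i)"
    by (rule homogeneous_sum) (rule cm)
  from homogeneous_power[OF this, of "n - 1"]
  have 1: "homogeneous n (n - 1) ((\<Sum>i=1..n. coeff_const [:lam i:] * var_x i) ^ (n - 1))" by simp
  have "homogeneous n (card {(i, j). (1 :: nat) \<le> i \<and> i + 1 < j \<and> j \<le> n})
     (\<Prod>x\<in>{(i, j). 1 \<le> i \<and> i + 1 < j \<and> j \<le> n}. case x of (i, j) \<Rightarrow> coeff_const var_q * var_x i - var_x j)"
    by (rule homogeneous_prod) (auto intro!: homogeneous_diff homogeneous_var[simplified] cm[simplified])
  from homogeneous_mult[OF 1 this] show ?thesis
    unfolding card_nonadjacent_pairs bracket_argument_def .
qed

lemma q_kernel_quotient: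
  "q_kernel q n z = (\<Prod>(i, j)\<in>{(i, j). 1 \<le> i \<and> i + 1 < j \<and> j \<le> n}. q * z i - z j) / vandermonde n z"
proof -
  have "q_kernel_factor q z i j = (if i + 1 < j then q * z i - z j else 1) / (if i < j then z i - z j else 1)" for i j
    by (simp add: q_kernel_factor_def)
  then have "q_kernel q n z = (\<Prod>i\<in>{1..n}. \<Prod>j\<in>{1..n}. if i + 1 < j then q * z i - z j else 1) / vandermonde n z"
    unfolding q_kernel_def vandermonde_def by (simp add: prod_dividef)
  also have "(\<Prod>i\<in>{1..n}. \<Prod>j\<in>{1..n}. if i + 1 < j then q * z i - z j else 1) =
     (\<Prod>(i, j)\<in>{(i, j). 1 \<le> i \<and> i + 1 < j \<and> j \<le> n}. q * z i - z j)"
    by (rule prod_pairs[symmetric]) simp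
  finally show ?thesis .
qed

lemma eval_bracket_argument:
  "subst_poly (\<lambda>p. poly p q) g (bracket_argument n lam) = linear_form n lam g ^ (n - 1) *
     (\<Prod>(i, j)\<in>{(i, j). 1 \<le> i \<and> i + 1 < j \<and> j \<le> n}. q * g i - g j)"
proof -
  have "subst_poly (\<lambda>p. poly p q) g (\<Sum>i=1..n. coeff_const [:lam i:] * var_x i) = linear_form n lam g"
    unfolding ev.subst_sum ev.subst_mult ev.subst_const ev.subst_var linear_form_def by simp
  moreover have "subst_poly (\<lambda>p. poly p q) g
      (\<Prod>(i, j)\<in>{(i, j). 1 \<le> i \<and> i + 1 < j \<and> j \<le> n}. coeff_const var_q * var_x i - var_x j) =
      (\<Prod>(i, j)\<in>{(i, j). 1 \<le> i \<and> i + 1 < j \<and> j \<le> n}. q * g i - g j)"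
    unfolding ev.subst_prod
    by (rule prod.cong[OF refl]) (auto simp: ev.subst_diff ev.subst_mult ev.subst_const ev.subst_var var_q_def)
  ultimately show ?thesis
    unfolding bracket_argument_def ev.subst_mult ev.subst_power by simp
qed

lemma eval_antisymmetrize:
  assumes "inj_on X {1..n}"
  shows "subst_poly (\<lambda>p. poly p q) X (antisymmetrize n (bracket_argument n lam)) =
    volume_at q n lam X * fact (n - 1) * vandermonde n X"
proof -
  let ?N = "\<lambda>z. \<Prod>(i, j)\<in>{(i, j). 1 \<le> i \<and> i + 1 < j \<and> j \<le> n}. q * z i - z j"
  have V: "vandermonde n X \<noteq> 0" by (rule vandermonde_nonzero[OF assms])
  have "subst_poly (\<lambda>p. poly p q) X (antisymmetrize n (bracket_argument n lam)) =
      (\<Sum>\<sigma> | \<sigma> permutes {1..n}. of_int (sign \<sigma>) * (linear_form n lam (X \<circ> \<sigma>) ^ (n - 1) * ?N (X \<circ> \<sigma>)))"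
    unfolding antisymmetrize_def ev.subst_sum ev.subst_sign ev.subst_permute_vars eval_bracket_argument ..
  also have "\<dots> = (\<Sum>\<sigma> | \<sigma> permutes {1..n}.
      (q_kernel q n (X \<circ> \<sigma>) * linear_form n lam (X \<circ> \<sigma>) ^ (n - 1) / fact (n - 1)) * (fact (n - 1) * vandermonde n X))"
  proof (rule sum.cong[OF refl])
    fix \<sigma> assume "\<sigma> \<in> {\<sigma>. \<sigma> permutes {1..n}}"
    then have v: "vandermonde n (X \<circ> \<sigma>) = of_int (sign \<sigma>) * vandermonde n X" by (simp add: vandermonde_permute)
    have k: "q_kernel q n (X \<circ> \<sigma>) * vandermonde n X = of_int (sign \<sigma>) * ?N (X \<circ> \<sigma>)"
      unfolding q_kernel_quotient v using V by (cases \<sigma> rule: sign_cases) simp_all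
    have "(q_kernel q n (X \<circ> \<sigma>) * linear_form n lam (X \<circ> \<sigma>) ^ (n - 1) / fact (n - 1)) * (fact (n - 1) * vandermonde n X) =
        (q_kernel q n (X \<circ> \<sigma>) * vandermonde n X) * linear_form n lam (X \<circ> \<sigma>) ^ (n - 1)"
      by simp
    then show "of_int (sign \<sigma>) * (linear_form n lam (X \<circ> \<sigma>) ^ (n - 1) * ?N (X \<circ> \<sigma>)) =
        (q_kernel q n (X \<circ> \<sigma>) * linear_form n lam (X \<circ> \<sigma>) ^ (n - 1) / fact (n - 1)) * (fact (n - 1) * vandermonde n X)"
      unfolding k by (simp only: mult_ac)
  qed
  also have "\<dots> = volume_at q n lam X * fact (n - 1) * vandermonde n X"
    unfolding volume_at_def sum_distrib_right[symmetric] by (simp only: mult.assoc)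
  finally show ?thesis .
qed

lemma lookup_const_mult: "Poly_Mapping.lookup (coeff_const a * f) m = a * Poly_Mapping.lookup f m"
proof -
  have "coeff_const a * f = (\<Sum>k\<in>Poly_Mapping.keys f. Poly_Mapping.single k (a * Poly_Mapping.lookup f k))"
    by (subst const.qpoly_expand[of f]) (simp add: sum_distrib_left coeff_const_def mult_single)
  then have "Poly_Mapping.lookup (coeff_const a * f) m =
      (\<Sum>k\<in>Poly_Mapping.keys f. if k = m then a * Poly_Mapping.lookup f m else 0)"
    by (auto simp: lookup_sum lookup_single when_def intro!: sum.cong)
  then show ?thesis by (simp add: in_keys_iff)
qed

text \<open>
  Both polynomials have coefficients in the same proportion to their coefficient at the
  staircase monomial. The proportionality constants are polynomials in \<open>q\<close>, so no division is
  performed.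
\<close>

lemma alternating_proportional:
  assumes "alternating n f" "homogeneous n (\<Sum>{0..<n}) f" "alternating n g" "homogeneous n (\<Sum>{0..<n}) g"
  shows "coeff_const (Poly_Mapping.lookup g (staircase n)) * f = coeff_const (Poly_Mapping.lookup f (staircase n)) * g"
proof (rule poly_mapping_eqI)
  fix m
  obtain s :: int where s: "\<And>f. alternating n f \<Longrightarrow> homogeneous n (\<Sum>{0..<n}) f \<Longrightarrow>
    Poly_Mapping.lookup f m = of_int s * Poly_Mapping.lookup f (staircase n)"
    using alternating_coefficient by blast
  show "Poly_Mapping.lookup (coeff_const (Poly_Mapping.lookup g (staircase n)) * f) m =
    Poly_Mapping.lookup (coeff_const (Poly_Mapping.lookup f (staircase n)) * g) m"
    unfolding lookup_const_mult s[OF assms(1,2)] s[OF assms(3,4)] by (simp only: mult_ac)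
qed

text \<open>
  If this coefficient vanished at some \<open>q\<close>, so would all others, and the Vandermonde product would
  be zero at every point.
\<close>

lemma vandermonde_staircase_coefficient_nonzero: "poly (Poly_Mapping.lookup (vandermonde n var_x) (staircase n)) q \<noteq> 0"
proof
  assume 0: "poly (Poly_Mapping.lookup (vandermonde n var_x) (staircase n)) q = 0"
  have "poly (Poly_Mapping.lookup (vandermonde n var_x) m) q = 0" for m
  proof -
    obtain s :: int where s: "\<And>f. alternating n f \<Longrightarrow> homogeneous n (\<Sum>{0..<n}) f \<Longrightarrow>
      Poly_Mapping.lookup f m = of_int s * Poly_Mapping.lookup f (staircase n)"
      using alternating_coefficient by blast
    show ?thesis unfolding s[OF alternating_vandermonde homogeneous_vandermonde] poly_mult 0 by simp
  qed
  then have "subst_poly (\<lambda>p. poly p q) real (vandermonde n var_x) = 0"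
    by (simp add: subst_poly_def)
  then show False
    unfolding ev.subst_vandermonde using vandermonde_nonzero[of real n] by (simp add: inj_on_def)
qed

lemma volume_at_proportional:
  assumes "inj_on X {1..n}"
  shows "poly (Poly_Mapping.lookup (vandermonde n var_x) (staircase n)) q * (volume_at q n lam X * fact (n - 1)) =
    poly (Poly_Mapping.lookup (antisymmetrize n (bracket_argument n lam)) (staircase n)) q"
proof -
  let ?A = "antisymmetrize n (bracket_argument n lam)" and ?V = "vandermonde n var_x :: qpoly"
  let ?a = "Poly_Mapping.lookup ?A (staircase n)" and ?b = "Poly_Mapping.lookup ?V (staircase n)"
  have "coeff_const ?b * ?A = coeff_const ?a * ?V"
    by (intro alternating_proportional alternating_antisymmetrize homogeneous_antisymmetrize
      homogeneous_bracket_argument alternating_vandermonde homogeneous_vandermonde)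
  then have "subst_poly (\<lambda>p. poly p q) X (coeff_const ?b * ?A) = subst_poly (\<lambda>p. poly p q) X (coeff_const ?a * ?V)"
    by simp
  then have "poly ?b q * (volume_at q n lam X * fact (n - 1) * vandermonde n X) = poly ?a q * vandermonde n X"
    unfolding ev.subst_mult ev.subst_const ev.subst_vandermonde eval_antisymmetrize[OF assms] .
  then show ?thesis using vandermonde_nonzero[OF assms] by (simp add: mult.assoc[symmetric])
qed

lemma volume_at_independent:
  assumes "inj_on X {1..n}" "inj_on X' {1..n}"
  shows "volume_at q n lam X = volume_at q n lam X'"
proof -
  let ?b = "poly (Poly_Mapping.lookup (vandermonde n var_x) (staircase n)) q"
  have "?b * (volume_at q n lam X * fact (n - 1)) = ?b * (volume_at q n lam X' * fact (n - 1))"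
    using volume_at_proportional[OF assms(1)] volume_at_proportional[OF assms(2)] by (rule trans[OF _ sym])
  then show ?thesis
    using vandermonde_staircase_coefficient_nonzero[of n q] by (simp only: mult_cancel_left mult_cancel_right fact_nonzero) simp
qed

theorem theorem6p8:
  fixes r :: nat and lam :: "nat \<Rightarrow> real"
  assumes "r \<ge> 1"
    and "\<And>i j. 1 \<le> i \<Longrightarrow> i \<le> j \<Longrightarrow> j \<le> r + 1 \<Longrightarrow> lam j \<le> lam i"
  shows "q_volume r lam =
    to_fract (coeff_const
      (\<Sum>u | u permutes {1..r}. var_q ^ perm_length u * [:proj_vol r (C_polytope r lam u):]))"
proof -
  let ?n = "Suc r"
  let ?A = "antisymmetrize ?n (bracket_argument ?n lam)" and ?V = "vandermonde ?n var_x :: qpoly"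
  let ?a = "Poly_Mapping.lookup ?A (staircase ?n)" and ?b = "Poly_Mapping.lookup ?V (staircase ?n)"
  let ?w = "\<Sum>u | u permutes {1..r}. var_q ^ perm_length u * [:proj_vol r (C_polytope r lam u):]"
  have dom: "dominant ?n lam" using assms(2) by (simp add: dominant_def)
  \<comment> \<open>both sides are polynomials in \<open>q\<close> that agree at every real \<open>q\<close>\<close>
  have "?a = ?b * (of_nat (fact r) * ?w)"
  proof -
    have "poly ?a q = poly (?b * (of_nat (fact r) * ?w)) q" for q
    proof -
      have "volume_at q ?n lam real =
          (\<Sum>u | u permutes {1..r}. q ^ perm_length u * proj_vol r (C_polytope r lam u))"
        by (rule volume_at_eq_weighted_volume[OF _ dom inj_on_of_nat]) (rule volume_at_independent)
      also have "\<dots> = poly ?w q"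
        unfolding poly_sum poly_mult poly_power var_q_def by (intro sum.cong refl) simp
      finally have "volume_at q ?n lam real = poly ?w q" .
      moreover have "poly ?b q * (volume_at q ?n lam real * fact r) = poly ?a q"
        using volume_at_proportional[OF inj_on_of_nat, of ?n q lam] unfolding diff_Suc_1 .
      moreover have "poly (of_nat (fact r)) q = (fact r :: real)"
        by (simp only: of_nat_poly poly_pCons poly_0 of_nat_fact mult_zero_right add_0_right)
      ultimately show ?thesis unfolding poly_mult by (simp only: mult.commute)
    qed
    then show ?thesis by (intro poly_eq_poly_eq_iff[THEN iffD1] ext)
  qed
  moreover have "coeff_const ?b * ?A = coeff_const ?a * ?V"
    by (intro alternating_proportional alternating_antisymmetrize homogeneous_antisymmetrize
      homogeneous_bracket_argument alternating_vandermonde homogeneous_vandermonde)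
  ultimately have "coeff_const ?b * ?A = coeff_const ?b * (coeff_const (of_nat (fact r) * ?w) * ?V)"
    by (simp only: const.c_mult mult.assoc)
  moreover have "coeff_const ?b \<noteq> 0"
  proof
    assume "coeff_const ?b = 0"
    then have "Poly_Mapping.lookup (coeff_const ?b) 0 = 0" by (simp only: lookup_zero)
    then have "?b = 0" by (simp only: coeff_const_def lookup_single_eq)
    then show False using vandermonde_staircase_coefficient_nonzero[of ?n 0] by simp
  qed
  ultimately have A: "?A = coeff_const (of_nat (fact r) * ?w) * ?V" by (simp only: mult_cancel_left) simp
  have V: "?V \<noteq> 0"
  proof
    assume "?V = 0"
    then have "?b = 0" by simp
    then show False using vandermonde_staircase_coefficient_nonzero[of ?n 0] by simp
  qed
  have of_nat: "coeff_const (of_nat k) = of_nat k" for k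
    by (induction k) (simp_all add: const.c_add const.c_0 const.c_1)
  have to_of_nat: "to_fract (of_nat k :: qpoly) = of_nat k" for k
    by (induction k) simp_all
  have "q_volume r lam = to_fract ?A / to_fract ?V / of_nat (fact r)"
    unfolding q_volume_def q_bracket_def partial_wo_def antisymmetrize_def bracket_argument_def vandermonde_pairs
    by simp
  also have "\<dots> = to_fract (coeff_const ?w)"
  proof -
    have F: "(of_nat (fact r) :: qpoly fract) \<noteq> 0"
      unfolding to_of_nat[symmetric] to_fract_eq_0_iff of_nat_eq_0_iff by (rule fact_nonzero)
    have V': "to_fract ?V \<noteq> 0" unfolding to_fract_eq_0_iff by (rule V)
    show ?thesis
      unfolding A const.c_mult of_nat to_fract_mult to_of_nat
        nonzero_mult_div_cancel_right[OF V'] nonzero_mult_div_cancel_left[OF F] ..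
  qed
  finally show ?thesis .
qed

end
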